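(* Let $X$ be a standard Borel space and let $\mathcal{R}$ be a Borel equivalence relation with countable classes on $X$ which is the countable free product of sub-relations $\mathcal{R}_i$ ($i\in I$). Let $\mathcal{S}$ be a sub-relation of $\mathcal{R}$ on $X$. Then $\mathcal{S}$ admits a countable free product decomposition $$\mathcal{S} = \Big(\mathop{\star}_{i \in I}\ \mathop{\star}_{k_i \in K(i)} \mathcal{S}_{k_i}\Big) \star \mathcal{T},$$ where each $K(i)$ is a countable set and, for every $i\in I$ and every $k_i\in K(i)$, there is an element $\phi_{k_i}$ of $[[\mathcal{R}]]$ defined on a Borel subset $A_{k_i}$ of $X$ such that $$\mathcal{S}_{k_i} = \big(\phi_{k_i}^{-1}\, \mathcal{R}_{i}|_{\phi_{k_i}(A_{k_i})}\, \phi_{k_i}\big) \cap \mathcal{S},$$ and where $\mathcal{T}$ is an arborable (treeable) sub-relation of $\mathcal{S}$. Moreover, for every $i\in I$ there exists $k_i\in K(i)$ such that $A_{k_i}=X$ and $\mathcal{S}_{k_i}=\mathcal{R}_i\cap\mathcal{S}$.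
   Context: A sub-relation of $\mathcal{R}$ defined on a Borel subset $A\subset X$ is a Borel equivalence relation on $A$ contained in $\mathcal{R}$ (if $A$ is not mentioned, $A=X$). A sub-relation defined on a Borel subset is, when needed, extended to the ambient space by equality outside that subset. $[[\mathcal{R}]]$ (the full pseudogroup) is the set of Borel isomorphisms $\phi:A\to B$ between Borel subsets of $X$ whose graph is contained in $\mathcal{R}$. If $\phi:A\to B$ is in $[[\mathcal{R}]]$ and $\mathcal{Q}$ is a sub-relation of $\mathcal{R}$ defined on $B$, then $\phi^{-1}\mathcal{Q}\phi$ is the sub-relation defined on $A$ by: $x,y\in A$ are equivalent iff $\phi(x),\phi(y)$ are $\mathcal{Q}$-equivalent. $\mathcal{Q}|_C$ denotes restriction to a Borel subset $C$. Countable free product: a relation $\mathcal{Q}$ is the free product of a countable family of sub-relations $(\mathcal{Q}_j)_{j\in J}$ if $\mathcal{Q}$ is generated by the $\mathcal{Q}_j$ (it is the smallest equivalence relation containing them) and, for every $n\ge 2$ and every $n$-tuple $(x_1,\dots,x_n)$ of points with $x_n=x_1$ and $(x_k,x_{k+1})\in \mathcal{Q}_{j_k}$ for $1\le k\le n-1$, where $j_k\ne j_{k+1}$ for $1\le k\le n-2$, there is $1\le k\le n-1$ with $x_k=x_{k+1}$. A Borel equivalence relation with countable classes on a standard Borel space $Y$ is arborable (treeable) if there is a symmetric Borel subset of $Y\times Y$ disjoint from the diagonal which, seen as a graph on $Y$, is acyclic and whose connected components are exactly the classes of the relation. *)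

theory Defs
  imports "HOL-Analysis.Analysis"
begin

text \<open>
  A standard Borel space is a measurable space whose \<open>\<sigma>\<close>-algebra is generated by some Polish
  topology on the underlying set. Only \<^term>\<open>space M\<close> and \<^term>\<open>sets M\<close> matter; the measure
  carried by \<^term>\<open>M\<close> is never used.
\<close>

definition standard_borel_space :: "'a measure \<Rightarrow> bool" where
  "standard_borel_space M \<longleftrightarrow>
    (\<exists>T. completely_metrizable_space T \<and> separable_space T \<and> topspace T = space M \<and>
         sets M = sigma_sets (space M) {U. openin T U})"

definition borel_equiv_on :: "'a measure \<Rightarrow> 'a set \<Rightarrow> 'a rel \<Rightarrow> bool" where
  "borel_equiv_on M A Q \<longleftrightarrow> A \<in> sets M \<and> Q \<in> sets (M \<Otimes>\<^sub>M M) \<and> equiv A Q"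

definition countable_classes :: "'a set \<Rightarrow> 'a rel \<Rightarrow> bool" where
  "countable_classes A Q \<longleftrightarrow> (\<forall>C \<in> A // Q. countable C)"

definition subrelation_on :: "'a measure \<Rightarrow> 'a rel \<Rightarrow> 'a set \<Rightarrow> 'a rel \<Rightarrow> bool" where
  "subrelation_on M R A Q \<longleftrightarrow> borel_equiv_on M A Q \<and> Q \<subseteq> R"

definition extend_by_equality :: "'a measure \<Rightarrow> 'a set \<Rightarrow> 'a rel \<Rightarrow> 'a rel" where
  "extend_by_equality M A Q = Q \<union> Id_on (space M - A)"

definition restrict_rel :: "'a rel \<Rightarrow> 'a set \<Rightarrow> 'a rel" where
  "restrict_rel Q C = Q \<inter> C \<times> C"

text \<open>The relation \<open>\<phi>\<^sup>-\<^sup>1 Q \<phi>\<close> on the domain \<open>A\<close> of \<open>\<phi>\<close>.\<close>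

definition pullback_rel :: "'a set \<Rightarrow> ('a \<Rightarrow> 'a) \<Rightarrow> 'a rel \<Rightarrow> 'a rel" where
  "pullback_rel A \<phi> Q = {(x, y). x \<in> A \<and> y \<in> A \<and> (\<phi> x, \<phi> y) \<in> Q}"

definition borel_isomorphism :: "'a measure \<Rightarrow> 'a set \<Rightarrow> 'a set \<Rightarrow> ('a \<Rightarrow> 'a) \<Rightarrow> bool" where
  "borel_isomorphism M A B \<phi> \<longleftrightarrow>
    bij_betw \<phi> A B \<and>
    \<phi> \<in> measurable (restrict_space M A) (restrict_space M B) \<and>
    the_inv_into A \<phi> \<in> measurable (restrict_space M B) (restrict_space M A)"

text \<open>
  Membership of \<open>\<phi> : A \<rightarrow> B\<close> in \<open>[[R]]\<close>. The values of \<open>\<phi>\<close> outside \<open>A\<close> are irrelevant.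
\<close>

definition in_full_pseudogroup ::
    "'a measure \<Rightarrow> 'a rel \<Rightarrow> 'a set \<Rightarrow> 'a set \<Rightarrow> ('a \<Rightarrow> 'a) \<Rightarrow> bool" where
  "in_full_pseudogroup M R A B \<phi> \<longleftrightarrow>
    A \<in> sets M \<and> B \<in> sets M \<and> borel_isomorphism M A B \<phi> \<and> (\<forall>x\<in>A. (x, \<phi> x) \<in> R)"

definition generated_by :: "'a set \<Rightarrow> 'a rel \<Rightarrow> 'j set \<Rightarrow> ('j \<Rightarrow> 'a rel) \<Rightarrow> bool" where
  "generated_by X Q J F \<longleftrightarrow>
    equiv X Q \<and> (\<forall>j\<in>J. F j \<subseteq> Q) \<and>
    (\<forall>E. equiv X E \<and> (\<forall>j\<in>J. F j \<subseteq> E) \<longrightarrow> Q \<subseteq> E)"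

definition free_family :: "'j set \<Rightarrow> ('j \<Rightarrow> 'a rel) \<Rightarrow> bool" where
  "free_family J F \<longleftrightarrow>
    (\<forall>n\<ge>2. \<forall>(x :: nat \<Rightarrow> 'a) (j :: nat \<Rightarrow> 'j).
       x n = x 1 \<and>
       (\<forall>k\<in>{1..n - 1}. j k \<in> J \<and> (x k, x (k + 1)) \<in> F (j k)) \<and>
       (\<forall>k\<in>{1..n - 2}. j k \<noteq> j (k + 1))
       \<longrightarrow> (\<exists>k\<in>{1..n - 1}. x k = x (k + 1)))"

definition countable_free_product ::
    "'a measure \<Rightarrow> 'a rel \<Rightarrow> 'j set \<Rightarrow> ('j \<Rightarrow> 'a rel) \<Rightarrow> bool" where
  "countable_free_product M Q J F \<longleftrightarrow>
    countable J \<and> (\<forall>j\<in>J. subrelation_on M Q (space M) (F j)) \<and>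
    generated_by (space M) Q J F \<and> free_family J F"

text \<open>
  The library predicate \<^const>\<open>acyclic\<close> concerns directed cycles and fails for every nonempty
  symmetric relation, so acyclicity of an undirected graph is defined here: there is no cycle
  through at least three pairwise distinct vertices.
\<close>

definition acyclic_graph :: "'a rel \<Rightarrow> bool" where
  "acyclic_graph G \<longleftrightarrow>
    \<not> (\<exists>xs. length xs \<ge> 3 \<and> distinct xs \<and> successively (\<lambda>x y. (x, y) \<in> G) xs \<and>
           (last xs, hd xs) \<in> G)"

text \<open>
  The connected component of a vertex \<open>x\<close> of the graph \<open>G\<close> is \<^term>\<open>G\<^sup>* `` {x}\<close>; hence
  \<^term>\<open>space M // G\<^sup>*\<close> is the set of connected components (isolated vertices included) and
  \<^term>\<open>space M // Q\<close> the set of classes.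
\<close>

definition arborable :: "'a measure \<Rightarrow> 'a rel \<Rightarrow> bool" where
  "arborable M Q \<longleftrightarrow>
    borel_equiv_on M (space M) Q \<and> countable_classes (space M) Q \<and>
    (\<exists>G. G \<in> sets (M \<Otimes>\<^sub>M M) \<and> sym G \<and> G \<inter> Id = {} \<and> acyclic_graph G \<and>
         space M // G\<^sup>* = space M // Q)"

text \<open>
  Index set and family of the decomposition
  \<open>(\<star>\<^sub>i\<^sub>\<in>\<^sub>I \<star>\<^sub>k\<^sub>\<in>\<^sub>K\<^sub>(\<^sub>i\<^sub>) S i k) \<star> T\<close>: the index
  \<^term>\<open>Some (i, k)\<close> stands for \<open>S i k\<close>, which lives on \<open>A i k\<close> and is extended by equality, and
  \<^const>\<open>None\<close> stands for \<open>T\<close>.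
\<close>

definition kurosh_index :: "'i set \<Rightarrow> ('i \<Rightarrow> 'k set) \<Rightarrow> ('i \<times> 'k) option set" where
  "kurosh_index I K = insert None (Some ` (SIGMA i:I. K i))"

definition kurosh_family ::
    "'a measure \<Rightarrow> ('i \<Rightarrow> 'k \<Rightarrow> 'a set) \<Rightarrow> ('i \<Rightarrow> 'k \<Rightarrow> 'a rel) \<Rightarrow> 'a rel \<Rightarrow>
      ('i \<times> 'k) option \<Rightarrow> 'a rel" where
  "kurosh_family M A S T p =
    (case p of None \<Rightarrow> T | Some (i, k) \<Rightarrow> extend_by_equality M (A i k) (S i k))"

end

theory Submission
  imports Defs
begin

text \<open>
  Freeness of the \<open>Ri\<close> means that the bipartite graph on an \<open>R\<close>-class \<open>C\<close> and the \<open>Ri\<close>-classes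
  contained in it is a tree, in which every vertex of the second kind can be cut off along any
  subset of its neighbours. Let \<open>D\<close> be an \<open>S\<close>-class inside \<open>C\<close>. Choose, in a Borel way that depends
  on \<open>D\<close> only, for each point \<open>z\<close> of \<open>C\<close> outside \<open>D\<close> a parent in one of the \<open>Ri\<close>-classes of \<open>z\<close>,
  so that following the parents leads to a root in \<open>D\<close>. Contracting these paths turns the tree of
  \<open>C\<close> (after replacing some of its edges) into a tree on \<open>D\<close>: each \<open>Ri\<close>-class \<open>v\<close> contributes the
  set of roots of a subset of \<open>v\<close> on which the root map is one of countably many Borel injections,
  and these sets are the classes of the \<open>S i k\<close>; the remaining edges form the graph of \<open>T\<close>. Cuts of
  the tree of \<open>C\<close> descend to \<open>D\<close>, which gives the freeness.

  The countably many Borel injections come from the Lusin--Novikov theorem. Its proof is the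
  separation argument for analytic sets: if the set were not covered by countably many Borel
  graphs, a Cantor scheme of pieces whose projections cannot be separated modulo such graphs would
  produce an uncountable section. The graphs obtained are those of total Borel functions, so that
  no theorem on injective images of Borel sets is needed.
\<close>

section \<open>Countable Borel sections\<close>

text \<open>The difficulty is to keep the contraction injective on a class \<open>v\<close> of
  \<open>Ri i\<close>, since several points of \<open>v\<close> may have the same root in
  \<open>D\<close>. Hence the bookkeeping by ranks: all points attached at one stage reach their
  roots through one index \<open>n\<close>, and only where \<open>g n (f n z) = z\<close>, so points
  of equal rank have different roots. The hub \<open>v\<close> keeps as neighbours only its points
  of minimal rank, on which a single injection gives the root; any other point of \<open>v\<close>
  hangs on one of these by an edge. This edge is contracted if it leads to the parent and becomes an
  edge of \<open>T\<close> otherwise. The rank serves as the index \<open>k\<close>. If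
  \<open>v\<close> meets \<open>D\<close>, the minimal rank is 0 and the injection is the identity,
  whence the distinguished factors \<open>Ri i \<inter> S\<close>. In general no point of
  \<open>D\<close> can be singled out in a Borel way, so the forest is rooted in all of
  \<open>D\<close> instead of a base point.\<close>

definition analytic_set :: "'p::topological_space set \<Rightarrow> bool" where
  "analytic_set A \<longleftrightarrow> (\<exists>F :: ('p \<times> (nat \<Rightarrow> nat)) set. closed F \<and> A = fst ` F)"

lemma continuous_on_snd_coord: "continuous_on UNIV (\<lambda>p :: 'p::topological_space \<times> (nat \<Rightarrow> nat). snd p k)"
  by (rule continuous_on_product_then_coordinatewise[OF continuous_on_snd[OF continuous_on_id]])

lemma continuous_on_reindex:
  fixes h :: "nat \<Rightarrow> nat"
  shows "continuous_on UNIV (\<lambda>p :: 'p::topological_space \<times> (nat \<Rightarrow> nat). (fst p, \<lambda>k. snd p (h k)))"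
  by (intro continuous_on_Pair continuous_on_fst continuous_on_id
      continuous_on_coordinatewise_then_product continuous_on_snd_coord)

lemma closed_reindex_vimage:
  fixes h :: "nat \<Rightarrow> nat" and F :: "('p::topological_space \<times> (nat \<Rightarrow> nat)) set"
  assumes "closed F"
  shows "closed {p. (fst p, \<lambda>k. snd p (h k)) \<in> F}"
  using closed_vimage[OF assms continuous_on_reindex[of h]] by (simp add: vimage_def)

lemma closed_coord_neq:
  "closed {p :: 'p::topological_space \<times> (nat \<Rightarrow> nat). snd p k \<noteq> n}"
proof -
  have "closed ((\<lambda>p :: 'p \<times> (nat \<Rightarrow> nat). snd p k) -` (- {n}))"
    by (rule closed_vimage[OF _ continuous_on_snd_coord]) (simp add: closed_def open_discrete)
  then show ?thesis by (simp add: vimage_def)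
qed

text \<open>The first coordinate of the witness records which set is meant; the remaining ones are a
  witness for that set.\<close>

lemma analytic_set_UN:
  fixes A :: "nat \<Rightarrow> 'p::topological_space set"
  assumes "\<And>n. analytic_set (A n)"
  shows "analytic_set (\<Union>n. A n)"
proof -
  from assms obtain F :: "nat \<Rightarrow> ('p \<times> (nat \<Rightarrow> nat)) set"
    where F: "\<And>n. closed (F n)" "\<And>n. A n = fst ` F n"
    unfolding analytic_set_def by metis
  let ?G = "{p. (fst p, \<lambda>k. snd p (Suc k)) \<in> F (snd p 0)}"
  have "?G = (\<Inter>n. {p. snd p 0 \<noteq> n} \<union> {p. (fst p, \<lambda>k. snd p (Suc k)) \<in> F n})" by auto
  also have "closed \<dots>"
    by (intro closed_INT ballI closed_Un closed_coord_neq closed_reindex_vimage F)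
  finally have "closed ?G" .
  moreover have "(\<Union>n. A n) = fst ` ?G"
  proof (intro equalityI subsetI)
    fix x assume "x \<in> (\<Union>n. A n)"
    then obtain n a where "(x, a) \<in> F n" by (auto simp: F(2))
    then have "(x, case_nat n a) \<in> ?G" by simp
    from imageI[OF this, of fst] show "x \<in> fst ` ?G" by simp
  next
    fix x assume "x \<in> fst ` ?G"
    then show "x \<in> (\<Union>n. A n)" by (force simp: F(2))
  qed
  ultimately show ?thesis unfolding analytic_set_def by blast
qed

text \<open>The witness interleaves one witness per set along the columns given by
  \<open>prod_encode\<close>.\<close>

lemma analytic_set_INT:
  fixes A :: "nat \<Rightarrow> 'p::topological_space set"
  assumes "\<And>n. analytic_set (A n)"
  shows "analytic_set (\<Inter>n. A n)"
proof -
  from assms obtain F :: "nat \<Rightarrow> ('p \<times> (nat \<Rightarrow> nat)) set"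
    where F: "\<And>n. closed (F n)" "\<And>n. A n = fst ` F n"
    unfolding analytic_set_def by metis
  let ?G = "\<Inter>n. {p. (fst p, \<lambda>k. snd p (prod_encode (n, k))) \<in> F n}"
  have "closed ?G"
    by (intro closed_INT ballI closed_reindex_vimage F)
  moreover have "(\<Inter>n. A n) = fst ` ?G"
  proof (intro equalityI subsetI)
    fix x assume "x \<in> (\<Inter>n. A n)"
    then have "\<forall>n. \<exists>a. (x, a) \<in> F n" by (fastforce simp: F(2))
    then obtain a where a: "\<And>n. (x, a n) \<in> F n" by metis
    then have "(x, \<lambda>m. case prod_decode m of (n, k) \<Rightarrow> a n k) \<in> ?G" by simp
    from imageI[OF this, of fst] show "x \<in> fst ` ?G" by simp
  next
    fix x assume "x \<in> fst ` ?G"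
    then show "x \<in> (\<Inter>n. A n)" by (force simp: F(2))
  qed
  ultimately show ?thesis unfolding analytic_set_def by blast
qed

lemma analytic_set_closed: "closed A \<Longrightarrow> analytic_set A"
  unfolding analytic_set_def
  by (intro exI[of _ "A \<times> UNIV"]) (auto intro: closed_Times)

text \<open>The generators already form a \<sigma>-algebra (\<open>sets_bianalytic_algebra\<close>),
  so Borel sets are seen to be analytic by checking that the identity map is measurable for
  it.\<close>

definition bianalytic_algebra :: "'p::topological_space measure" where
  "bianalytic_algebra = sigma UNIV {A. analytic_set A \<and> analytic_set (- A)}"

lemma sets_bianalytic_algebra: "A \<in> sets bianalytic_algebra \<longleftrightarrow> analytic_set A \<and> analytic_set (- A)"
proof
  assume "A \<in> sets bianalytic_algebra"
  then have "A \<in> sigma_sets UNIV {A. analytic_set A \<and> analytic_set (- A)}"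
    by (simp add: bianalytic_algebra_def)
  then show "analytic_set A \<and> analytic_set (- A)"
  proof (induction rule: sigma_sets.induct)
    case Empty
    then show ?case by (simp add: analytic_set_closed)
  next
    case (Compl a)
    then show ?case by (simp add: Compl_eq_Diff_UNIV[symmetric])
  next
    case (Union a)
    have "- (\<Union>n. a n) = (\<Inter>n. - a n)" by auto
    then show ?case using Union by (auto intro: analytic_set_UN analytic_set_INT)
  qed simp
qed (simp add: bianalytic_algebra_def)

lemma space_bianalytic_algebra [simp]: "space bianalytic_algebra = UNIV"
  by (simp add: bianalytic_algebra_def)

lemma continuous_measurable_bianalytic:
  fixes f :: "'p::topological_space \<Rightarrow> nat \<Rightarrow> nat"
  assumes "continuous_on UNIV f"
  shows "f \<in> measurable bianalytic_algebra borel"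
proof (rule measurable_coordinatewise_then_product)
  fix k
  have c: "continuous_on UNIV (\<lambda>p. f p k)"
    by (rule continuous_on_product_then_coordinatewise[OF assms])
  show "(\<lambda>p. f p k) \<in> borel_measurable bianalytic_algebra"
  proof (rule measurableI)
    fix B :: "nat set"
    have "closed ((\<lambda>p. f p k) -` B)" "closed ((\<lambda>p. f p k) -` (- B))"
      by (rule closed_vimage[OF _ c], simp add: closed_def open_discrete)+
    then show "(\<lambda>p. f p k) -` B \<inter> space bianalytic_algebra \<in> sets bianalytic_algebra"
      by (simp add: sets_bianalytic_algebra analytic_set_closed vimage_Compl)
  qed simp
qed

lemma analytic_set_borel:
  fixes A :: "((nat \<Rightarrow> nat) \<times> (nat \<Rightarrow> nat)) set"
  assumes "A \<in> sets borel"
  shows "analytic_set A"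
proof -
  have "(\<lambda>p :: (nat \<Rightarrow> nat) \<times> (nat \<Rightarrow> nat). (fst p, snd p)) \<in> measurable bianalytic_algebra (borel \<Otimes>\<^sub>M borel)"
    by (intro measurable_Pair continuous_measurable_bianalytic continuous_on_fst continuous_on_snd
        continuous_on_id)
  then have "(\<lambda>p. p) \<in> measurable bianalytic_algebra (borel :: ((nat \<Rightarrow> nat) \<times> (nat \<Rightarrow> nat)) measure)"
    by (simp add: borel_prod)
  from measurable_sets[OF this assms] show ?thesis
    by (simp add: sets_bianalytic_algebra)
qed

text \<open>
  Separation of finitely many projections modulo countably many Borel graphs. With \<open>H = {}\<close>
  and two pieces this is the separation in Lusin's theorem.
\<close>

definition graph_separation ::
    "('z \<Rightarrow> nat \<Rightarrow> nat) \<Rightarrow> ('z \<Rightarrow> nat \<Rightarrow> nat) \<Rightarrow> nat set \<Rightarrow> (nat \<Rightarrow> 'z set) \<Rightarrow>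
      ((nat \<Rightarrow> nat) \<Rightarrow> nat \<Rightarrow> nat) set \<Rightarrow> (nat \<Rightarrow> (nat \<Rightarrow> nat) set) \<Rightarrow> bool" where
  "graph_separation X Y J Z H B \<longleftrightarrow>
     countable H \<and> H \<subseteq> borel_measurable borel \<and> (\<forall>j\<in>J. B j \<in> sets borel) \<and>
     (\<forall>x. \<exists>j\<in>J. x \<notin> B j) \<and>
     (\<forall>j\<in>J. \<forall>z\<in>Z j. (\<exists>h\<in>H. Y z = h (X z)) \<or> X z \<in> B j)"

definition separated_mod_graphs ::
    "('z \<Rightarrow> nat \<Rightarrow> nat) \<Rightarrow> ('z \<Rightarrow> nat \<Rightarrow> nat) \<Rightarrow> nat set \<Rightarrow> (nat \<Rightarrow> 'z set) \<Rightarrow> bool" where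
  "separated_mod_graphs X Y J Z \<longleftrightarrow> (\<exists>H B. graph_separation X Y J Z H B)"

section \<open>Refining families of pieces that cannot be separated\<close>

lemma choice2:
  assumes "\<forall>p. \<exists>a b. P p a b"
  obtains f g where "\<And>p. P p (f p) (g p)"
proof -
  have "\<forall>p. \<exists>c. P p (fst c) (snd c)" using assms by auto
  then obtain h where "\<forall>p. P p (fst (h p)) (snd (h p))" unfolding choice_iff by blast
  then show ?thesis using that[of "\<lambda>p. fst (h p)" "\<lambda>p. snd (h p)"] by simp
qed

lemma separated_mod_graphsI:
  assumes "countable H" "H \<subseteq> borel_measurable borel" "\<And>j. j \<in> J \<Longrightarrow> B j \<in> sets borel"
    "\<And>x. (\<And>j. j \<in> J \<Longrightarrow> x \<in> B j) \<Longrightarrow> False"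
    "\<And>j z. j \<in> J \<Longrightarrow> z \<in> Z j \<Longrightarrow> (\<exists>h\<in>H. Y z = h (X z)) \<or> X z \<in> B j"
  shows "separated_mod_graphs X Y J Z"
  unfolding separated_mod_graphs_def graph_separation_def
  using assms by (intro exI[of _ H] exI[of _ B]) blast

lemma graph_separationD:
  assumes "graph_separation X Y J Z H B"
  shows "countable H" "H \<subseteq> borel_measurable borel" "\<And>j. j \<in> J \<Longrightarrow> B j \<in> sets borel"
    "\<exists>j\<in>J. x \<notin> B j"
    "\<And>j z. j \<in> J \<Longrightarrow> z \<in> Z j \<Longrightarrow> (\<exists>h\<in>H. Y z = h (X z)) \<or> X z \<in> B j"
  using assms unfolding graph_separation_def by blast+

text \<open>Separations for the countably many parts combine: the sets at \<open>j\<close> are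
  united, all others intersected, and a common point of the results would be a common point for one
  single part.\<close>

lemma not_separated_refine:
  fixes c :: "'z \<Rightarrow> nat"
  assumes bad: "\<not> separated_mod_graphs X Y J Z" and j: "j \<in> J"
  obtains m where "\<not> separated_mod_graphs X Y J (Z(j := {z \<in> Z j. c z = m}))"
proof -
  have "separated_mod_graphs X Y J Z"
    if "\<And>m. separated_mod_graphs X Y J (Z(j := {z \<in> Z j. c z = m}))"
  proof -
    have "\<forall>m. \<exists>H B. graph_separation X Y J (Z(j := {z \<in> Z j. c z = m})) H B"
      using that unfolding separated_mod_graphs_def by (rule allI)
    then obtain H B where
      HB: "\<And>m. graph_separation X Y J (Z(j := {z \<in> Z j. c z = m})) (H m) (B m)"
      by (rule choice2) blast
    note HB5 = graph_separationD(5)[OF HB]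
    show ?thesis
    proof (rule separated_mod_graphsI[where H = "\<Union>m. H m" and
          B = "\<lambda>i. if i = j then \<Union>m. B m j else \<Inter>m. B m i"])
      fix x assume x: "\<And>i. i \<in> J \<Longrightarrow> x \<in> (if i = j then \<Union>m. B m j else \<Inter>m. B m i)"
      from x[OF j] obtain m where "x \<in> B m j" by auto
      moreover have "x \<in> B m i" if "i \<in> J" "i \<noteq> j" for i using x[OF that(1)] that(2) by auto
      ultimately show False using graph_separationD(4)[OF HB, of x m] by metis
    next
      fix i z assume iz: "i \<in> J" "z \<in> Z i"
      show "(\<exists>h\<in>\<Union>m. H m. Y z = h (X z)) \<or>
        X z \<in> (if i = j then \<Union>m. B m j else \<Inter>m. B m i)"
      proof (cases "i = j")
        case True
        then show ?thesis using HB5[of j z "c z"] iz by auto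
      next
        case False
        have "(\<exists>h\<in>H m. Y z = h (X z)) \<or> X z \<in> B m i" for m
          using HB5[of i z m] iz False by simp
        then show ?thesis using False by auto
      qed
    next
      show "countable (\<Union>m. H m)" using graph_separationD(1)[OF HB] by auto
      show "(\<Union>m. H m) \<subseteq> borel_measurable borel" using graph_separationD(2)[OF HB] by blast
      show "(if i = j then \<Union>m. B m j else \<Inter>m. B m i) \<in> sets borel" if "i \<in> J" for i
        using graph_separationD(3)[OF HB that] graph_separationD(3)[OF HB j] by (auto intro!: sets.countable_INT')
    qed
  qed
  then show ?thesis using bad that by blast
qed

text \<open>This is where graphs enter. If any two parts of \<open>Z j\<close> that differ in a
  coordinate of \<open>Y\<close> could be separated, then off the graphs used for this,
  \<open>X z\<close> would determine every coordinate of \<open>Y z\<close> wherever the other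
  pieces leave room; one further Borel graph would absorb \<open>Z j\<close> there.\<close>

lemma not_separated_split:
  assumes bad: "\<not> separated_mod_graphs X Y J Z" and j: "j \<in> J" and j': "j' \<notin> J"
    and J: "finite J"
  obtains k m m' where "m \<noteq> m'" "\<not> separated_mod_graphs X Y (insert j' J)
      (Z(j := {z \<in> Z j. Y z k = m}, j' := {z \<in> Z j. Y z k = m'}))"
proof -
  let ?Z = "\<lambda>k m m'. Z(j := {z \<in> Z j. Y z k = m}, j' := {z \<in> Z j. Y z k = m'})"
  have neq: "j \<noteq> j'" using j j' by auto
  have "separated_mod_graphs X Y J Z"
    if "\<And>k m m'. m \<noteq> m' \<Longrightarrow> separated_mod_graphs X Y (insert j' J) (?Z k m m')"
  proof -
    have "\<forall>p. \<exists>H B. fst (snd p) \<noteq> snd (snd p) \<longrightarrow> graph_separation X Y (insert j' J)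
        (?Z (fst p) (fst (snd p)) (snd (snd p))) H B"
      using that unfolding separated_mod_graphs_def by blast
    then obtain H0 B0 where HB0: "\<And>p. fst (snd p) \<noteq> snd (snd p) \<Longrightarrow> graph_separation X Y
        (insert j' J) (?Z (fst p) (fst (snd p)) (snd (snd p))) (H0 p) (B0 p)"
      by (rule choice2) blast
    define H B where "H = (\<lambda>k m m'. H0 (k, m, m'))" and "B = (\<lambda>k m m'. B0 (k, m, m'))"
    have HB: "m \<noteq> m' \<Longrightarrow>
        graph_separation X Y (insert j' J) (?Z k m m') (H k m m') (B k m m')" for k m m'
      using HB0[of "(k, m, m')"] unfolding H_def B_def by simp
    note HB3 = graph_separationD(3)[OF HB] and HB5 = graph_separationD(5)[OF HB]
    define H' where "H' = (\<Union>k. \<Union>m. \<Union>m'\<in>-{m}. H k m m')"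
    \<comment> \<open>\<open>E k m\<close> collects the \<open>x\<close> that all separations allow
      for a point of \<open>Z j\<close> whose \<open>k\<close>-th coordinate is \<open>m\<close>.
      Such a point may fall into the first or the second part, hence the two conditions.\<close>
    define E where "E = (\<lambda>k m. \<Inter>m'\<in>-{m}. B k m m' j \<inter> B k m' m j')"
    define h where "h = (\<lambda>x k. LEAST m. x \<in> E k m)"
    \<comment> \<open>Over \<open>C\<close> the other pieces exclude nothing, so the sets
      \<open>E k m\<close> are disjoint there for fixed \<open>k\<close>, and \<open>h\<close> reads
      off the only possible coordinate.\<close>
    define C where "C = (\<Inter>k. \<Inter>m. \<Inter>m'\<in>-{m}. \<Inter>i\<in>J - {j}. B k m m' i)"
    have E: "E k m \<in> sets borel" for k m
      unfolding E_def by (intro sets.countable_INT'' sets.Int HB3) (use j in auto)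
    have hm: "h \<in> borel_measurable borel"
      unfolding h_def
    proof (rule measurable_coordinatewise_then_product)
      fix k
      have "(\<lambda>x. LEAST m. x \<in> E k m) \<in> measurable borel (count_space UNIV)"
        using E by (intro measurable_Least) (auto simp: pred_def)
      then show "(\<lambda>x. LEAST m. x \<in> E k m) \<in> borel_measurable borel"
        by (simp add: measurable_count_space_eq2_countable measurable_def)
    qed
    have Cm: "C \<in> sets borel"
    proof -
      show ?thesis unfolding C_def
        by (intro sets.countable_INT'' HB3) (use J in \<open>auto intro: countable_finite\<close>)
    qed
    have inE: "X z \<in> E k (Y z k)" if z: "z \<in> Z j" "\<And>h. h \<in> H' \<Longrightarrow> Y z \<noteq> h (X z)" for z k
    proof -
      have "X z \<in> B k (Y z k) m' j \<and> X z \<in> B k m' (Y z k) j'" if m': "m' \<noteq> Y z k" for m'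
      proof
        show "X z \<in> B k (Y z k) m' j"
          using HB5[of "Y z k" m' j z k] m' z j neq unfolding H'_def by auto
        show "X z \<in> B k m' (Y z k) j'"
          using HB5[of m' "Y z k" j' z k] m' z j neq unfolding H'_def by auto
      qed
      then show ?thesis unfolding E_def by auto
    qed
    have disj: "False" if "x \<in> C" "x \<in> E k m" "x \<in> E k m'" "m \<noteq> m'" for x k m m'
    proof -
      have "x \<in> B k m m' i" if i: "i \<in> insert j' J" for i
      proof -
        consider "i = j" | "i = j'" | "i \<in> J - {j}" using i by auto
        then show ?thesis
          using \<open>x \<in> C\<close> \<open>x \<in> E k m\<close> \<open>x \<in> E k m'\<close> \<open>m \<noteq> m'\<close>
          unfolding C_def E_def by cases blast+
      qed
      then show False using graph_separationD(4)[OF HB[OF that(4)], of x k] by blast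
    qed
    show ?thesis
    proof (rule separated_mod_graphsI[where H = "insert h H'" and
          B = "\<lambda>i. if i = j then - C else (\<Inter>k. \<Inter>m. \<Inter>m'\<in>-{m}. B k m m' i)"])
      show "countable (insert h H')" unfolding H'_def
        by (intro countable_insert countable_UN graph_separationD(1)[OF HB]) auto
      show "insert h H' \<subseteq> borel_measurable borel" unfolding H'_def
        by (intro insert_subsetI hm UN_least graph_separationD(2)[OF HB]) auto
      show "(if i = j then - C else (\<Inter>k. \<Inter>m. \<Inter>m'\<in>-{m}. B k m m' i)) \<in> sets borel"
        if i: "i \<in> J" for i
      proof -
        have "(\<Inter>m'\<in>-{m}. B k m m' i) \<in> sets borel" for k m
          by (intro sets.countable_INT'' HB3) (use i in auto)
        then have "(\<Inter>k. \<Inter>m. \<Inter>m'\<in>-{m}. B k m m' i) \<in> sets borel"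
          by (auto intro!: sets.countable_INT')
        then show ?thesis using Cm by auto
      qed
      show False if x: "\<And>i. i \<in> J \<Longrightarrow> x \<in> (if i = j then - C else (\<Inter>k. \<Inter>m. \<Inter>m'\<in>-{m}. B k m m' i))" for x
      proof -
        have "x \<in> C" unfolding C_def using x by (force split: if_splits)
        then show False using x[OF j] by simp
      qed
      show "(\<exists>h\<in>insert h H'. Y z = h (X z)) \<or>
         X z \<in> (if i = j then - C else (\<Inter>k. \<Inter>m. \<Inter>m'\<in>-{m}. B k m m' i))"
        if iz: "i \<in> J" "z \<in> Z i" for i z
      proof (cases "\<exists>h\<in>H'. Y z = h (X z)")
        case False
        show ?thesis
        proof (cases "i = j")
          case True
          show ?thesis
          proof (cases "X z \<in> C")
            case xC: True
            have "h (X z) k = Y z k" for k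
            proof -
              have e: "X z \<in> E k (Y z k)" using inE[of z k] iz True False by auto
              have "y = Y z k" if "X z \<in> E k y" for y using disj[OF xC that e] by blast
              with e show ?thesis unfolding h_def by (metis (mono_tags, lifting) LeastI)
            qed
            then show ?thesis by auto
          qed (simp add: True)
        next
          case ij: False
          have "X z \<in> B k m m' i" if "m \<noteq> m'" for k m m'
          proof -
            have "i \<noteq> j'" using iz j' by auto
            then have "(\<exists>h\<in>H k m m'. Y z = h (X z)) \<or> X z \<in> B k m m' i"
              using HB5[OF that, of i z k] iz ij by simp
            moreover have "H k m m' \<subseteq> H'" unfolding H'_def
              by (intro subsetI UN_I[of k] UN_I[of m] UN_I[of m']) (use that in auto)
            ultimately show ?thesis using False by blast
          qed
          then show ?thesis using ij by auto
        qed
      qed auto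
    qed
  qed
  then show ?thesis using bad that by blast
qed

lemma not_separated_refine_all:
  fixes c :: "'z \<Rightarrow> nat"
  assumes J: "finite J" and bad: "\<not> separated_mod_graphs X Y J Z"
  obtains Z' where "\<not> separated_mod_graphs X Y J Z'" "\<And>j. j \<in> J \<Longrightarrow> Z' j \<subseteq> Z j"
    "\<And>j. j \<in> J \<Longrightarrow> \<exists>m. \<forall>z\<in>Z' j. c z = m"
proof -
  have "\<exists>Z'. \<not> separated_mod_graphs X Y J Z' \<and> (\<forall>j\<in>J. Z' j \<subseteq> Z j) \<and>
          (\<forall>j\<in>J'. \<exists>m. \<forall>z\<in>Z' j. c z = m)" if "J' \<subseteq> J" for J'
    using finite_subset[OF that J] that
  proof (induction J')
    case empty
    then show ?case using bad by auto
  next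
    case (insert j J')
    then obtain Z' where Z': "\<not> separated_mod_graphs X Y J Z'" "\<forall>j\<in>J. Z' j \<subseteq> Z j"
      "\<forall>j\<in>J'. \<exists>m. \<forall>z\<in>Z' j. c z = m" by auto
    from insert.prems have j: "j \<in> J" by simp
    obtain m where m: "\<not> separated_mod_graphs X Y J (Z'(j := {z \<in> Z' j. c z = m}))"
      using not_separated_refine[OF Z'(1) j] by blast
    show ?case
    proof (intro exI[of _ "Z'(j := {z \<in> Z' j. c z = m})"] conjI m)
      show "\<forall>i\<in>J. (Z'(j := {z \<in> Z' j. c z = m})) i \<subseteq> Z i" using Z'(2) j by auto
      show "\<forall>i\<in>insert j J'. \<exists>n. \<forall>z\<in>(Z'(j := {z \<in> Z' j. c z = m})) i. c z = n"
        using Z'(3) insert.hyps by auto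
    qed
  qed
  from this[OF order_refl] that show ?thesis by blast
qed

definition pieces_apart :: "('z \<Rightarrow> nat \<Rightarrow> nat) \<Rightarrow> 'z set \<Rightarrow> 'z set \<Rightarrow> bool" where
  "pieces_apart Y A B \<longleftrightarrow> (\<exists>k m m'. m \<noteq> m' \<and> (\<forall>z\<in>A. Y z k = m) \<and> (\<forall>z\<in>B. Y z k = m'))"

lemma pieces_apart_mono:
  "pieces_apart Y A B \<Longrightarrow> A' \<subseteq> A \<Longrightarrow> B' \<subseteq> B \<Longrightarrow> pieces_apart Y A' B'"
  unfolding pieces_apart_def by blast

text \<open>The parts of piece \<open>j\<close> are numbered \<open>j\<close> and
  \<open>N + j\<close>, so that after \<open>n\<close> doublings the binary digits of a number are
  the choices made along a branch.\<close>

lemma not_separated_double: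
  assumes bad: "\<not> separated_mod_graphs X Y {..<N} Z"
  obtains Z' where "\<not> separated_mod_graphs X Y {..<N + N} Z'"
    "\<And>j. j < N \<Longrightarrow> Z' j \<subseteq> Z j" "\<And>j. j < N \<Longrightarrow> Z' (N + j) \<subseteq> Z j"
    "\<And>j. j < N \<Longrightarrow> pieces_apart Y (Z' j) (Z' (N + j))"
proof -
  have "\<exists>Z'. \<not> separated_mod_graphs X Y {..<N + l} Z' \<and> (\<forall>j<N. Z' j \<subseteq> Z j) \<and>
          (\<forall>j<l. Z' (N + j) \<subseteq> Z j \<and> pieces_apart Y (Z' j) (Z' (N + j)))" if "l \<le> N" for l
    using that
  proof (induction l)
    case 0
    then show ?case using bad by auto
  next
    case (Suc l)
    then obtain Z' where Z': "\<not> separated_mod_graphs X Y {..<N + l} Z'" "\<And>j. j < N \<Longrightarrow> Z' j \<subseteq> Z j"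
      "\<And>j. j < l \<Longrightarrow> Z' (N + j) \<subseteq> Z j" "\<And>j. j < l \<Longrightarrow> pieces_apart Y (Z' j) (Z' (N + j))" by auto
    have l: "l \<in> {..<N + l}" "N + l \<notin> {..<N + l}" "finite {..<N + l}" using Suc.prems by auto
    obtain k m m' where km: "m \<noteq> m'"
      "\<not> separated_mod_graphs X Y (insert (N + l) {..<N + l})
         (Z'(l := {z \<in> Z' l. Y z k = m}, N + l := {z \<in> Z' l. Y z k = m'}))"
      by (rule not_separated_split[OF Z'(1) l]) (rule that)
    define W where "W = Z'(l := {z \<in> Z' l. Y z k = m}, N + l := {z \<in> Z' l. Y z k = m'})"
    have "insert (N + l) {..<N + l} = {..<N + Suc l}" by auto
    then have "\<not> separated_mod_graphs X Y {..<N + Suc l} W" using km(2) unfolding W_def by metis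
    moreover have "pieces_apart Y (W l) (W (N + l))"
      unfolding pieces_apart_def W_def using km(1) Suc.prems
      by (intro exI[of _ k] exI[of _ m] exI[of _ m']) auto
    moreover have "pieces_apart Y (W j) (W (N + j))" if "j < l" for j
      using Z'(4)[OF that] that Suc.prems unfolding W_def by simp
    moreover have "W j \<subseteq> Z j" if "j < N" for j
      using Z'(2)[OF that] Suc.prems that unfolding W_def by auto
    moreover have "W (N + j) \<subseteq> Z j" if "j < Suc l" for j
      using Z'(3)[of j] Z'(2)[of j] Suc.prems that unfolding W_def by (cases "j = l") auto
    ultimately show ?case by (intro exI[of _ W]) (auto simp: less_Suc_eq)
  qed
  from this[OF order_refl] that show ?thesis by blast
qed

lemma not_separated_nonempty:
  assumes "\<not> separated_mod_graphs X Y J Z" "j \<in> J"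
  shows "Z j \<noteq> {}"
proof
  assume "Z j = {}"
  have "separated_mod_graphs X Y J Z"
  proof (rule separated_mod_graphsI[where H = "{}" and B = "\<lambda>i. if i = j then {} else UNIV"])
    show False if "\<And>i. i \<in> J \<Longrightarrow> x \<in> (if i = j then {} else UNIV)" for x :: "nat \<Rightarrow> nat"
      using that[OF assms(2)] by simp
  qed (use \<open>Z j = {}\<close> in auto)
  with assms show False by simp
qed

text \<open>Otherwise two disjoint cylinders at coordinate \<open>k\<close> separate the family
  without any graph.\<close>

lemma not_separated_same_X:
  assumes bad: "\<not> separated_mod_graphs X Y J Z" and ij: "i \<in> J" "j \<in> J"
    and a: "\<And>z. z \<in> Z i \<Longrightarrow> X z k = a" and b: "\<And>z. z \<in> Z j \<Longrightarrow> X z k = b"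
  shows "a = b"
proof (rule ccontr)
  assume ab: "a \<noteq> b"
  have coord: "{x :: nat \<Rightarrow> nat. x k = c} \<in> sets borel" for c
    by measurable
  have "separated_mod_graphs X Y J Z"
  proof (rule separated_mod_graphsI[where H = "{}" and
        B = "\<lambda>l. if l = i then {x. x k = a} else if l = j then {x. x k = b} else UNIV"])
    show False if "\<And>l. l \<in> J \<Longrightarrow> x \<in> (if l = i then {x. x k = a} else if l = j then {x. x k = b} else UNIV)" for x
    proof (cases "i = j")
      case True
      then show False using not_separated_nonempty[OF bad ij(1)] a b ab by blast
    next
      case False
      then show False using that[OF ij(1)] that[OF ij(2)] ab by simp
    qed
  qed (use a b coord in auto)
  with bad show False by simp
qed

section \<open>The Cantor scheme and the covering by Borel graphs\<close>

primrec branch_index :: "nat set \<Rightarrow> nat \<Rightarrow> nat" where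
  "branch_index \<alpha> 0 = 0"
| "branch_index \<alpha> (Suc n) = (if n \<in> \<alpha> then 2 ^ n + branch_index \<alpha> n else branch_index \<alpha> n)"

lemma branch_index_less: "branch_index \<alpha> n < 2 ^ n"
  by (induction n) auto

lemma branch_index_cong: "\<alpha> \<inter> {..<n} = \<beta> \<inter> {..<n} \<Longrightarrow> branch_index \<alpha> n = branch_index \<beta> n"
proof (induction n)
  case (Suc n)
  then have "\<alpha> \<inter> {..<n} = \<beta> \<inter> {..<n}" "n \<in> \<alpha> \<longleftrightarrow> n \<in> \<beta>" by (auto simp: lessThan_Suc)
  with Suc.IH show ?case by simp
qed simp

lemma tendsto_fun_coordinatewise:
  fixes f :: "'b \<Rightarrow> 'i \<Rightarrow> 'c::topological_space"
  assumes "\<And>i. ((\<lambda>c. f c i) \<longlongrightarrow> l i) F"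
  shows "(f \<longlongrightarrow> l) F"
proof -
  have "limitin (product_topology (\<lambda>i. euclidean) UNIV) f l F"
    using assms by (simp add: limitin_componentwise)
  then show ?thesis by (simp add: euclidean_product_topology)
qed

lemma uncountable_UNIV_nat_set: "uncountable (UNIV :: nat set set)"
  unfolding uncountable_def using Cantors_theorem[of "UNIV :: nat set"] by auto

text \<open>A separation of a single piece is a covering by countably many Borel graphs, because its
  only set \<open>B 0\<close> has to be empty. If there is none, doubling yields limits
  \<open>l \<alpha>\<close>, one for each set of naturals, with the same first and distinct second
  coordinates: an uncountable section.\<close>

theorem lusin_novikov_cover:
  fixes P :: "((nat \<Rightarrow> nat) \<times> (nat \<Rightarrow> nat)) set"
  assumes P: "P \<in> sets borel" and cnt: "\<And>x. countable {y. (x, y) \<in> P}"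
  obtains h :: "nat \<Rightarrow> (nat \<Rightarrow> nat) \<Rightarrow> nat \<Rightarrow> nat"
  where "\<And>n. h n \<in> borel_measurable borel" "\<And>x y. (x, y) \<in> P \<Longrightarrow> \<exists>n. y = h n x"
proof -
  from analytic_set_borel[OF P] obtain F :: "(((nat \<Rightarrow> nat) \<times> (nat \<Rightarrow> nat)) \<times> (nat \<Rightarrow> nat)) set"
    where F: "closed F" "P = fst ` F" unfolding analytic_set_def by blast
  define X where "X = (\<lambda>z :: ((nat \<Rightarrow> nat) \<times> (nat \<Rightarrow> nat)) \<times> (nat \<Rightarrow> nat). fst (fst z))"
  define Y where "Y = (\<lambda>z :: ((nat \<Rightarrow> nat) \<times> (nat \<Rightarrow> nat)) \<times> (nat \<Rightarrow> nat). snd (fst z))"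
  define A where "A = (\<lambda>z :: ((nat \<Rightarrow> nat) \<times> (nat \<Rightarrow> nat)) \<times> (nat \<Rightarrow> nat). snd z)"
  \<comment> \<open>Besides the coordinates of the pair, those of the witness are fixed: limits are
    known to stay in the closed set \<open>F\<close>, not in its projection
    \<open>P\<close>.\<close>
  define key where "key = (\<lambda>n z. to_nat (map (X z) [0..<n], map (Y z) [0..<n], map (A z) [0..<n]))"
  have key: "X z k = X z' k \<and> Y z k = Y z' k \<and> A z k = A z' k" if "key n z = key n z'" "k < n" for n z z' k
    using that unfolding key_def by simp
  have "separated_mod_graphs X Y {..<1} (\<lambda>_. F)"
  proof (rule ccontr)
    assume bad: "\<not> separated_mod_graphs X Y {..<1} (\<lambda>_. F)"
    define Q where "Q = (\<lambda>n Z. \<not> separated_mod_graphs X Y {..<2 ^ n} Z \<and>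
       (\<forall>j<2 ^ n :: nat. Z j \<subseteq> F) \<and> (\<forall>j<2 ^ n :: nat. \<exists>m. \<forall>z\<in>Z j. key n z = m))"
    define L where "L = (\<lambda>(n::nat) Z Z'. \<forall>j<2 ^ n :: nat. Z' j \<subseteq> Z j \<and> Z' (2 ^ n + j) \<subseteq> Z j \<and>
       pieces_apart Y (Z' j) (Z' (2 ^ n + j)))"
    have "\<exists>Z. \<forall>n. Q n (Z n) \<and> L n (Z n) (Z (Suc n))"
    proof (rule dependent_nat_choice)
      show "\<exists>Z. Q 0 Z" unfolding Q_def key_def using bad by (intro exI[of _ "\<lambda>_. F"]) auto
    next
      fix Z n assume Z: "Q n Z"
      then have "\<not> separated_mod_graphs X Y {..<2 ^ n} Z" unfolding Q_def by simp
      then obtain Z1 where Z1: "\<not> separated_mod_graphs X Y {..<2 ^ n + 2 ^ n} Z1"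
        "\<And>j. j < 2 ^ n \<Longrightarrow> Z1 j \<subseteq> Z j" "\<And>j. j < 2 ^ n \<Longrightarrow> Z1 (2 ^ n + j) \<subseteq> Z j"
        "\<And>j. j < 2 ^ n \<Longrightarrow> pieces_apart Y (Z1 j) (Z1 (2 ^ n + j))"
        by (rule not_separated_double) (rule that)
      obtain Z2 where Z2: "\<not> separated_mod_graphs X Y {..<2 ^ n + 2 ^ n} Z2"
        "\<And>j. j \<in> {..<2 ^ n + 2 ^ n} \<Longrightarrow> Z2 j \<subseteq> Z1 j"
        "\<And>j. j \<in> {..<2 ^ n + 2 ^ n} \<Longrightarrow> \<exists>m. \<forall>z\<in>Z2 j. key (Suc n) z = m"
        by (rule not_separated_refine_all[OF finite_lessThan Z1(1)]) (rule that)
      have L: "L n Z Z2"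
        unfolding L_def
      proof (intro allI impI conjI)
        fix j :: nat assume j: "j < 2 ^ n"
        then have j2: "Z2 j \<subseteq> Z1 j" "Z2 (2 ^ n + j) \<subseteq> Z1 (2 ^ n + j)" using Z2(2) by auto
        show "Z2 j \<subseteq> Z j" "Z2 (2 ^ n + j) \<subseteq> Z j" using j2 Z1(2,3)[OF j] by auto
        show "pieces_apart Y (Z2 j) (Z2 (2 ^ n + j))" by (rule pieces_apart_mono[OF Z1(4)[OF j] j2])
      qed
      have "Z2 j \<subseteq> F" if j: "j < 2 ^ Suc n" for j
      proof (cases "j < 2 ^ n")
        case True
        then show ?thesis using L Z unfolding L_def Q_def by blast
      next
        case False
        then obtain j' where "j = 2 ^ n + j'" "j' < 2 ^ n"
          using j by (metis add_less_cancel_left le_iff_add mult_2 not_le power_Suc)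
        then show ?thesis using L Z unfolding L_def Q_def by blast
      qed
      then have "Q (Suc n) Z2" unfolding Q_def using Z2(1,3) by (simp add: mult_2)
      with L show "\<exists>Z'. Q (Suc n) Z' \<and> L n Z Z'" by blast
    qed
    then obtain Z where ZQ: "\<And>n. Q n (Z n)" and ZL: "\<And>n. L n (Z n) (Z (Suc n))" by blast
    define V where "V = (\<lambda>\<alpha> n. Z n (branch_index \<alpha> n))"
    have VSuc: "V \<alpha> (Suc n) \<subseteq> V \<alpha> n" for \<alpha> n
      using ZL[of n] branch_index_less[of \<alpha> n] unfolding V_def L_def by simp
    have Vmono: "V \<alpha> n \<subseteq> V \<alpha> m" if "m \<le> n" for \<alpha> n m
      using lift_Suc_antimono_le[of "V \<alpha>", OF VSuc that] .
    have VF: "V \<alpha> n \<subseteq> F" for \<alpha> n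
      using ZQ[of n] branch_index_less[of \<alpha> n] unfolding V_def Q_def by simp
    have Vkey: "key n z = key n z'" if "z \<in> V \<alpha> n" "z' \<in> V \<alpha> n" for \<alpha> n z z'
      using ZQ[of n] branch_index_less[of \<alpha> n] that unfolding V_def Q_def by metis
    have "V \<alpha> n \<noteq> {}" for \<alpha> n
      unfolding V_def using ZQ[of n] branch_index_less[of \<alpha> n]
      by (intro not_separated_nonempty[of X Y "{..<2 ^ n}"]) (auto simp: Q_def)
    then have Vsome: "(SOME z. z \<in> V \<alpha> n) \<in> V \<alpha> n" for \<alpha> n
      by (simp add: some_in_eq)
    define s where "s = (\<lambda>\<alpha> n. SOME z. z \<in> V \<alpha> n)"
    have s: "s \<alpha> n \<in> V \<alpha> n" for \<alpha> n
      unfolding s_def by (rule Vsome)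
    \<comment> \<open>Coordinate \<open>k\<close> is constant on a piece only from level
      \<open>Suc k\<close> on; the diagonal value is the limit along the branch.\<close>
    define l where "l = (\<lambda>\<alpha>. ((\<lambda>k. X (s \<alpha> (Suc k)) k, \<lambda>k. Y (s \<alpha> (Suc k)) k), \<lambda>k. A (s \<alpha> (Suc k)) k))"
    have agree: "X z k = X (l \<alpha>) k \<and> Y z k = Y (l \<alpha>) k \<and> A z k = A (l \<alpha>) k"
      if "z \<in> V \<alpha> n" "k < n" for z \<alpha> n k
    proof -
      have "z \<in> V \<alpha> (Suc k)" using Vmono[of "Suc k" n] that by auto
      from key[OF Vkey[OF this s], of k] show ?thesis
        by (simp add: l_def X_def Y_def A_def)
    qed
    have lF: "l \<alpha> \<in> F" for \<alpha>
    proof -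
      have ev: "\<forall>\<^sub>F n in sequentially. k < n" for k :: nat
        using eventually_gt_at_top by blast
      have "(\<lambda>n. X (s \<alpha> n)) \<longlonglongrightarrow> X (l \<alpha>)" "(\<lambda>n. Y (s \<alpha> n)) \<longlonglongrightarrow> Y (l \<alpha>)"
        "(\<lambda>n. A (s \<alpha> n)) \<longlonglongrightarrow> A (l \<alpha>)"
        by (intro tendsto_fun_coordinatewise tendsto_eventually eventually_mono[OF ev]; use agree[OF s] in blast)+
      then have "(\<lambda>n. ((X (s \<alpha> n), Y (s \<alpha> n)), A (s \<alpha> n))) \<longlonglongrightarrow> ((X (l \<alpha>), Y (l \<alpha>)), A (l \<alpha>))"
        by (intro tendsto_Pair)
      then have "s \<alpha> \<longlonglongrightarrow> l \<alpha>" by (simp add: X_def Y_def A_def)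
      then show ?thesis
        by (rule Lim_in_closed_set[OF F(1) always_eventually sequentially_bot, rotated])
           (use s VF in blast)
    qed
    have Xeq: "X (l \<alpha>) = X (l \<beta>)" for \<alpha> \<beta>
    proof
      fix k
      show "X (l \<alpha>) k = X (l \<beta>) k"
      proof (rule not_separated_same_X[of X Y "{..<2 ^ Suc k}" "Z (Suc k)"])
        show "\<not> separated_mod_graphs X Y {..<2 ^ Suc k} (Z (Suc k))" using ZQ[of "Suc k"] by (simp add: Q_def)
        show "branch_index \<alpha> (Suc k) \<in> {..<2 ^ Suc k}" "branch_index \<beta> (Suc k) \<in> {..<2 ^ Suc k}"
          using branch_index_less by blast+
        show "X z k = X (l \<alpha>) k" if "z \<in> Z (Suc k) (branch_index \<alpha> (Suc k))" for z
          using agree[of z \<alpha> "Suc k" k] that unfolding V_def by blast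
        show "X z k = X (l \<beta>) k" if "z \<in> Z (Suc k) (branch_index \<beta> (Suc k))" for z
          using agree[of z \<beta> "Suc k" k] that unfolding V_def by blast
      qed
    qed
    have neq: "Y (l \<alpha>) \<noteq> Y (l \<beta>)" if n: "n \<in> \<alpha>" "n \<notin> \<beta>" "\<alpha> \<inter> {..<n} = \<beta> \<inter> {..<n}" for \<alpha> \<beta> n
    proof -
      have "pieces_apart Y (V \<beta> (Suc n)) (V \<alpha> (Suc n))"
        using ZL[of n] branch_index_less[of \<alpha> n] branch_index_cong[OF n(3)] n(1,2)
        unfolding V_def L_def by simp
      then obtain k m m' where k: "m \<noteq> m'" "\<And>z. z \<in> V \<beta> (Suc n) \<Longrightarrow> Y z k = m"
        "\<And>z. z \<in> V \<alpha> (Suc n) \<Longrightarrow> Y z k = m'" unfolding pieces_apart_def by blast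
      define N where "N = max (Suc n) (Suc k)"
      have N: "Suc n \<le> N" "k < N" unfolding N_def by auto
      have "Y (l \<alpha>) k = m'"
        using agree[OF s N(2), of \<alpha>] k(3)[of "s \<alpha> N"] Vmono[OF N(1)] s by (metis subsetD)
      moreover have "Y (l \<beta>) k = m"
        using agree[OF s N(2), of \<beta>] k(2)[of "s \<beta> N"] Vmono[OF N(1)] s by (metis subsetD)
      ultimately show ?thesis using k(1) by auto
    qed
    have "inj (\<lambda>\<alpha>. Y (l \<alpha>))"
    proof (rule injI, rule ccontr)
      fix \<alpha> \<beta> assume eq: "Y (l \<alpha>) = Y (l \<beta>)" and ne: "\<alpha> \<noteq> \<beta>"
      define n where "n = (LEAST n. \<not> (n \<in> \<alpha> \<longleftrightarrow> n \<in> \<beta>))"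
      have ex: "\<exists>n. \<not> (n \<in> \<alpha> \<longleftrightarrow> n \<in> \<beta>)" using ne by blast
      have n: "\<not> (n \<in> \<alpha> \<longleftrightarrow> n \<in> \<beta>)" unfolding n_def using LeastI_ex[OF ex] .
      have "\<alpha> \<inter> {..<n} = \<beta> \<inter> {..<n}"
      proof -
        have "m \<in> \<alpha> \<longleftrightarrow> m \<in> \<beta>" if "m < n" for m
          using not_less_Least[OF that[unfolded n_def]] by simp
        then show ?thesis by auto
      qed
      then show False using neq[of n \<alpha> \<beta>] neq[of n \<beta> \<alpha>] n eq by metis
    qed
    moreover have "range (\<lambda>\<alpha>. Y (l \<alpha>)) \<subseteq> {y. (X (l {}), y) \<in> P}"
    proof clarify
      fix \<alpha>
      have "fst (l \<alpha>) \<in> P" using lF[of \<alpha>] F(2) by blast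
      then show "(X (l {}), Y (l \<alpha>)) \<in> P" using Xeq[of "{}" \<alpha>] by (simp add: X_def Y_def)
    qed
    ultimately have "countable (UNIV :: nat set set)"
      using countable_subset[OF _ cnt] countable_image_inj_on by blast
    then show False using uncountable_UNIV_nat_set by simp
  qed
  then obtain H B where HB: "graph_separation X Y {..<1} (\<lambda>_. F) H B"
    unfolding separated_mod_graphs_def by blast
  have PH: "\<exists>h\<in>H. y = h x" if xy: "(x, y) \<in> P" for x y
  proof -
    obtain z where "z \<in> F" "fst z = (x, y)" using xy F(2) by auto
    then show ?thesis
      using graph_separationD(5)[OF HB, of 0 z] graph_separationD(4)[OF HB, of x]
      by (auto simp: X_def Y_def)
  qed
  \<comment> \<open>The constant function makes the set nonempty, as an enumeration by
    \<open>from_nat_into\<close> requires.\<close>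
  define h where "h = from_nat_into (insert (\<lambda>_ _. 0) H)"
  have H: "countable (insert (\<lambda>_ _. 0) H)" using graph_separationD(1)[OF HB] by simp
  show ?thesis
  proof (rule that)
    show "h n \<in> borel_measurable borel" for n
    proof -
      have "h n \<in> insert (\<lambda>_ _. 0) H" unfolding h_def by (rule from_nat_into) simp
      then show ?thesis using graph_separationD(2)[OF HB] by auto
    qed
    show "\<exists>n. y = h n x" if "(x, y) \<in> P" for x y
    proof -
      obtain g where "g \<in> H" "y = g x" using PH[OF \<open>(x, y) \<in> P\<close>] by blast
      moreover have "\<exists>n. h n = g"
        unfolding h_def using from_nat_into_surj[OF H, of g] \<open>g \<in> H\<close> by blast
      ultimately show ?thesis by blast
    qed
  qed
qed

section \<open>Coding a standard Borel space by sequences of natural numbers\<close>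

theorem standard_borel_coding:
  assumes M: "standard_borel_space M" and ne: "space M \<noteq> {}"
  obtains e :: "'a \<Rightarrow> nat \<Rightarrow> nat" and r :: "(nat \<Rightarrow> nat) \<Rightarrow> 'a"
  where "e \<in> measurable M borel" "r \<in> measurable borel M" "\<And>x. x \<in> space M \<Longrightarrow> r (e x) = x"
proof -
  from M obtain T where T: "completely_metrizable_space T" "separable_space T"
    "topspace T = space M" "sets M = sigma_sets (space M) {U. openin T U}"
    unfolding standard_borel_space_def by blast
  from T(1) obtain X d where X: "Metric_space X d" "Metric_space.mcomplete X d"
    "T = Metric_space.mtopology X d" unfolding completely_metrizable_space_def by blast
  interpret Metric_space X d by (rule X(1))
  have XM: "X = space M" using T(3) X(3) by simp
  have openM: "U \<in> sets M" if "openin mtopology U" for U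
    using that T(4) X(3) by (auto intro: sigma_sets.Basic)
  from T(2) obtain C where C: "countable C" "C \<subseteq> X" "mtopology closure_of C = X"
    unfolding separable_space_def X(3) by auto
  have "C \<noteq> {}" using C(3) ne XM by auto
  define u where "u = from_nat_into C"
  have ran: "range u = C" unfolding u_def by (rule range_from_nat_into[OF \<open>C \<noteq> {}\<close> C(1)])
  have uX: "u n \<in> X" for n using ran C(2) by auto
  have dense: "\<exists>m. d x (u m) < \<epsilon>" if "x \<in> X" "\<epsilon> > 0" for x \<epsilon>
  proof -
    have "x \<in> mtopology closure_of C" using C(3) that by simp
    then obtain y where "y \<in> C" "y \<in> mball x \<epsilon>" using \<open>\<epsilon> > 0\<close> unfolding metric_closure_of by auto
    then show ?thesis using ran by (metis imageE in_mball)
  qed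
  define e where "e = (\<lambda>x k. LEAST m. d x (u m) < (1 / 2) ^ k)"
  have e: "d x (u (e x k)) < (1 / 2) ^ k" if "x \<in> X" for x k
    unfolding e_def by (rule LeastI_ex, rule dense[OF that]) simp
  have e_meas: "e \<in> measurable M borel"
    unfolding e_def
  proof (rule measurable_coordinatewise_then_product)
    fix k :: nat
    have "Measurable.pred M (\<lambda>x. d x (u m) < (1 / 2) ^ k)" for m
    proof -
      have "{x \<in> space M. d x (u m) < (1 / 2) ^ k} = mball (u m) ((1 / 2) ^ k)"
        using uX[of m] by (auto simp: XM[symmetric] commute)
      then show ?thesis using openM[OF openin_mball] by (simp add: pred_def)
    qed
    then have "(\<lambda>x. LEAST m. d x (u m) < (1 / 2) ^ k) \<in> measurable M (count_space UNIV)"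
      by (intro measurable_Least)
    then show "(\<lambda>x. LEAST m. d x (u m) < (1 / 2) ^ k) \<in> borel_measurable M"
      by (simp add: measurable_count_space_eq2_countable measurable_def)
  qed
  \<comment> \<open>Codes of points satisfy this because
    \<open>(1/2)^k + (1/2)^(Suc k) < 2 * (1/2)^k\<close>. Summed up, the bound puts the limit within
    \<open>4 * (1/2)^k\<close> of the \<open>k\<close>-th term, uniformly in the sequence.\<close>
  define L where "L = (\<lambda>c :: nat \<Rightarrow> nat. \<forall>k. d (u (c k)) (u (c (Suc k))) < 2 * (1 / 2) ^ k)"
  have eL: "L (e x)" if x: "x \<in> X" for x
    unfolding L_def
  proof
    fix k
    have "d (u (e x k)) (u (e x (Suc k))) \<le> d (u (e x k)) x + d x (u (e x (Suc k)))"
      by (rule triangle) (use uX x in auto)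
    also have "\<dots> < 2 * (1 / 2) ^ k"
    proof -
      have "(1 / 2 :: real) ^ Suc k = (1 / 2) ^ k / 2" "(1 / 2 :: real) ^ k > 0" by simp_all
      then show ?thesis using e[OF x, of k] e[OF x, of "Suc k"] commute[of x "u (e x k)"] by linarith
    qed
    finally show "d (u (e x k)) (u (e x (Suc k))) < 2 * (1 / 2) ^ k" .
  qed
  have Ld: "d (u (c k)) (u (c (k + n))) \<le> 4 * (1 / 2) ^ k - 4 * (1 / 2) ^ (k + n)" if "L c" for c k n
  proof (induction n)
    case (Suc n)
    have "d (u (c k)) (u (c (k + Suc n))) \<le> d (u (c k)) (u (c (k + n))) + d (u (c (k + n))) (u (c (Suc (k + n))))"
      using triangle uX by simp
    moreover have "d (u (c (k + n))) (u (c (Suc (k + n)))) < 2 * (1 / 2) ^ (k + n)"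
      using \<open>L c\<close> unfolding L_def by blast
    ultimately show ?case using Suc by simp
  qed (simp add: uX)
  have Ld': "d (u (c k)) (u (c n)) \<le> 4 * (1 / 2) ^ k" if "L c" "k \<le> n" for c k n
  proof -
    have "4 * (1 / 2 :: real) ^ n \<ge> 0" by simp
    moreover have "d (u (c k)) (u (c n)) \<le> 4 * (1 / 2) ^ k - 4 * (1 / 2) ^ n"
      using Ld[OF that(1), of k "n - k"] that(2) by simp
    ultimately show ?thesis by linarith
  qed
  have cauchy: "MCauchy (\<lambda>k. u (c k))" if "L c" for c
    unfolding MCauchy_def
  proof (intro conjI allI impI)
    show "range (\<lambda>k. u (c k)) \<subseteq> X" using uX by auto
    fix \<epsilon> :: real assume "\<epsilon> > 0"
    then have "\<epsilon> / 8 > 0" by simp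
    then obtain N where N: "(1 / 2) ^ N < \<epsilon> / 8" using real_arch_pow_inv[of "\<epsilon> / 8" "1 / 2"] by auto
    show "\<exists>N. \<forall>n n'. N \<le> n \<longrightarrow> N \<le> n' \<longrightarrow> d (u (c n)) (u (c n')) < \<epsilon>"
    proof (intro exI[of _ N] allI impI)
      fix n n' assume n: "N \<le> n" "N \<le> n'"
      have "d (u (c n)) (u (c n')) \<le> d (u (c n)) (u (c N)) + d (u (c N)) (u (c n'))"
        using triangle uX by simp
      then show "d (u (c n)) (u (c n')) < \<epsilon>"
        using Ld'[OF that n(1)] Ld'[OF that n(2)] N commute[of "u (c n)" "u (c N)"] by linarith
    qed
  qed
  define lim where "lim = (\<lambda>c. SOME x. limitin mtopology (\<lambda>k. u (c k)) x sequentially)"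
  have lim: "limitin mtopology (\<lambda>k. u (c k)) (lim c) sequentially" if "L c" for c
    unfolding lim_def by (rule someI_ex) (use X(2) cauchy[OF that] in \<open>auto simp: mcomplete_def\<close>)
  have limX: "lim c \<in> X" if "L c" for c
    using limitin_mspace[OF lim[OF that]] .
  have limd: "d (u (c k)) (lim c) \<le> 4 * (1 / 2) ^ k" if "L c" for c k
  proof (rule field_le_epsilon)
    fix \<epsilon> :: real assume "\<epsilon> > 0"
    then have "\<forall>\<^sub>F n in sequentially. d (u (c n)) (lim c) < \<epsilon>"
      using lim[OF that] unfolding limitin_metric by (auto elim: eventually_mono)
    then obtain n where n: "n \<ge> k" "d (u (c n)) (lim c) < \<epsilon>"
      unfolding eventually_sequentially by (meson nat_le_linear order_refl le_trans)
    have "d (u (c k)) (lim c) \<le> d (u (c k)) (u (c n)) + d (u (c n)) (lim c)"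
      using triangle uX limX[OF that] by simp
    then show "d (u (c k)) (lim c) \<le> 4 * (1 / 2) ^ k + \<epsilon>"
      using Ld'[OF that n(1)] n(2) by linarith
  qed
  \<comment> \<open>Sequences outside \<open>L\<close> go to a fixed point, which makes
    \<open>r\<close> a total Borel left inverse of \<open>e\<close>; no images of Borel sets have to
    be considered.\<close>
  define r where "r = (\<lambda>c. if L c then lim c else u 0)"
  have rX: "r c \<in> X" for c unfolding r_def using limX uX by auto
  have re: "r (e x) = x" if x: "x \<in> X" for x
  proof -
    have "limitin mtopology (\<lambda>k. u (e x k)) x sequentially"
      unfolding limitin_metric
    proof (intro conjI allI impI x)
      fix \<epsilon> :: real assume "\<epsilon> > 0"
      then obtain N where N: "(1 / 2) ^ N < \<epsilon>" using real_arch_pow_inv[of \<epsilon> "1 / 2"] by auto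
      have "u (e x n) \<in> X \<and> d (u (e x n)) x < \<epsilon>" if "n \<ge> N" for n
      proof -
        have "(1 / 2 :: real) ^ n \<le> (1 / 2) ^ N" using that by (intro power_decreasing) auto
        then have "d x (u (e x n)) < \<epsilon>" using e[OF x, of n] N by linarith
        then show ?thesis using uX by (simp add: commute)
      qed
      then show "\<forall>\<^sub>F n in sequentially. u (e x n) \<in> X \<and> d (u (e x n)) x < \<epsilon>"
        unfolding eventually_sequentially by blast
    qed
    then have "lim (e x) = x" using limitin_metric_unique[OF lim[OF eL[OF x]]] by simp
    then show ?thesis using eL[OF x] by (simp add: r_def)
  qed
  have r_meas: "r \<in> measurable borel M"
  proof (rule measurable_sigma_sets[OF T(4)])
    show "{U. openin T U} \<subseteq> Pow (space M)" using T(3) openin_subset by blast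
    show "r \<in> space borel \<rightarrow> space M" using rX XM by auto
    fix U assume "U \<in> {U. openin T U}"
    then have U: "openin mtopology U" using X(3) by simp
    have pL: "Measurable.pred borel L"
    proof -
      have L': "L = (\<lambda>c. \<forall>k. \<exists>m n. c k = m \<and> c (Suc k) = n \<and> d (u m) (u n) < 2 * (1 / 2) ^ k)"
        unfolding L_def by auto
      show ?thesis unfolding L' by measurable
    qed
    \<comment> \<open>The uniform bound turns membership of the limit in an open set into a
      countable condition on the terms: some closed ball of the guaranteed radius lies in
      \<open>U\<close>.\<close>
    have "r c \<in> U \<longleftrightarrow> (L c \<and> (\<exists>k m. c k = m \<and> mcball (u m) (4 * (1 / 2) ^ k) \<subseteq> U)) \<or> (\<not> L c \<and> u 0 \<in> U)" for c
    proof (cases "L c")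
      case True
      have "(\<exists>k. mcball (u (c k)) (4 * (1 / 2) ^ k) \<subseteq> U)" if lU: "lim c \<in> U"
      proof -
        from U lU obtain \<epsilon> where eps: "\<epsilon> > 0" "mball (lim c) \<epsilon> \<subseteq> U"
          unfolding openin_mtopology by blast
        then have "\<epsilon> / 8 > 0" by simp
        then obtain k where k: "(1 / 2) ^ k < \<epsilon> / 8" using real_arch_pow_inv[of "\<epsilon> / 8" "1 / 2"] by auto
        have "mcball (u (c k)) (4 * (1 / 2) ^ k) \<subseteq> mball (lim c) \<epsilon>"
        proof
          fix y assume y: "y \<in> mcball (u (c k)) (4 * (1 / 2) ^ k)"
          have "d (lim c) y \<le> d (lim c) (u (c k)) + d (u (c k)) y"
            using triangle y limX[OF True] by auto
          then show "y \<in> mball (lim c) \<epsilon>"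
            using y limX[OF True] limd[OF True, of k] k commute[of "lim c" "u (c k)"] by auto
        qed
        with eps show ?thesis by blast
      qed
      moreover have "lim c \<in> U" if "mcball (u (c k)) (4 * (1 / 2) ^ k) \<subseteq> U" for k
        using that limd[OF True, of k] limX[OF True] uX by auto
      ultimately show ?thesis using True by (auto simp: r_def)
    qed (simp add: r_def)
    then have "r -` U \<inter> space borel = {c. (L c \<and> (\<exists>k m. c k = m \<and> mcball (u m) (4 * (1 / 2) ^ k) \<subseteq> U)) \<or> (\<not> L c \<and> u 0 \<in> U)}"
      by auto
    also have "\<dots> = {c \<in> space borel. (L c \<and> (\<exists>k m. c k = m \<and> mcball (u m) (4 * (1 / 2) ^ k) \<subseteq> U)) \<or> (\<not> L c \<and> u 0 \<in> U)}"
      by simp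
    also have "\<dots> \<in> sets borel"
      using pL by measurable
    finally show "r -` U \<inter> space borel \<in> sets borel" .
  qed
  show ?thesis by (rule that[OF e_meas r_meas]) (use re XM in auto)
qed

text \<open>Points are determined by the countably many Borel coordinates of their code.\<close>

lemma diagonal_measurable:
  assumes M: "standard_borel_space M"
  shows "Measurable.pred (M \<Otimes>\<^sub>M M) (\<lambda>p. fst p = snd p)"
proof (cases "space M = {}")
  case True
  then have "space (M \<Otimes>\<^sub>M M) = {}" by (simp add: space_pair_measure)
  then show ?thesis by (simp add: pred_def)
next
  case False
  from standard_borel_coding[OF M False] obtain e r where
    e: "e \<in> measurable M (borel :: (nat \<Rightarrow> nat) measure)" and re: "\<And>x. x \<in> space M \<Longrightarrow> r (e x) = x"
    by metis
  have ek: "(\<lambda>x. e x k) \<in> measurable M borel" for k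
    by (rule measurable_product_then_coordinatewise[OF e])
  have "Measurable.pred (M \<Otimes>\<^sub>M M) (\<lambda>p. \<forall>k. e (fst p) k = e (snd p) k)"
    using ek by measurable
  moreover have "fst p = snd p \<longleftrightarrow> (\<forall>k. e (fst p) k = e (snd p) k)" if "p \<in> space (M \<Otimes>\<^sub>M M)" for p
  proof -
    have "fst p \<in> space M" "snd p \<in> space M" using that by (auto simp: space_pair_measure)
    then show ?thesis using re by (metis ext)
  qed
  ultimately show ?thesis by (simp cong: measurable_cong)
qed

text \<open>
  The partial Borel injections whose graphs cover \<open>R\<close> are the restrictions of \<open>f n\<close> to
  \<open>{x. g n (f n x) = x}\<close>, with inverse \<open>g n\<close>; total functions avoid domains in the sequel.
\<close>

theorem feldman_moore:
  assumes M: "standard_borel_space M" and R: "borel_equiv_on M (space M) R"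
    and cnt: "countable_classes (space M) R"
  obtains f g :: "nat \<Rightarrow> 'a \<Rightarrow> 'a"
  where "\<And>n. f n \<in> measurable M M" "\<And>n. g n \<in> measurable M M"
    "f 0 = (\<lambda>x. x)" "g 0 = (\<lambda>x. x)"
    "\<And>n x. x \<in> space M \<Longrightarrow> (x, f n x) \<in> R" "\<And>n x. x \<in> space M \<Longrightarrow> (x, g n x) \<in> R"
    "\<And>x y. (x, y) \<in> R \<Longrightarrow> \<exists>n. f n x = y \<and> g n y = x"
proof -
  have Rm: "R \<in> sets (M \<Otimes>\<^sub>M M)" and eqR: "equiv (space M) R"
    using R unfolding borel_equiv_on_def by auto
  have RX: "x \<in> space M" "y \<in> space M" if "(x, y) \<in> R" for x y
    using sets.sets_into_space[OF Rm] that by (auto simp: space_pair_measure)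
  obtain h :: "nat \<Rightarrow> 'a \<Rightarrow> 'a" where h: "\<And>n. h n \<in> measurable M M"
    "\<And>x y. (x, y) \<in> R \<Longrightarrow> \<exists>n. h n x = y"
  proof (cases "space M = {}")
    case True
    show ?thesis by (rule that[of "\<lambda>_ x. x"]) (use True RX in auto)
  next
    case False
    obtain e :: "'a \<Rightarrow> nat \<Rightarrow> nat" and r where e: "e \<in> measurable M borel"
      and r: "r \<in> measurable borel M" and re: "\<And>x. x \<in> space M \<Longrightarrow> r (e x) = x"
      by (rule standard_borel_coding[OF M False]) (rule that)
    define P where "P = {p :: (nat \<Rightarrow> nat) \<times> (nat \<Rightarrow> nat).
      (\<forall>k. e (r (fst p)) k = fst p k) \<and> (\<forall>k. e (r (snd p)) k = snd p k) \<and> (r (fst p), r (snd p)) \<in> R}"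
    have ek: "(\<lambda>c. e (r c) k) \<in> borel_measurable borel" for k
      by (rule measurable_product_then_coordinatewise[OF measurable_compose[OF r e]])
    have "Measurable.pred (borel \<Otimes>\<^sub>M borel) (\<lambda>p :: (nat \<Rightarrow> nat) \<times> (nat \<Rightarrow> nat).
      (\<forall>k. e (r (fst p)) k = fst p k) \<and> (\<forall>k. e (r (snd p)) k = snd p k) \<and> (r (fst p), r (snd p)) \<in> R)"
    proof -
      have "Measurable.pred borel (\<lambda>c. \<forall>k. e (r c) k = c k)"
      proof (rule pred_intros_countable)
        fix k
        have "Measurable.pred borel (\<lambda>c. e (r c) k = m)" "Measurable.pred borel (\<lambda>c :: nat \<Rightarrow> nat. c k = m)" for m
          using ek[of k] by measurable
        then have "Measurable.pred borel (\<lambda>c. \<exists>m. c k = m \<and> e (r c) k = m)"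
          by (intro pred_intros_countable pred_intros_logic)
        then show "Measurable.pred borel (\<lambda>c. e (r c) k = c k)" by simp
      qed
      note c = measurable_compose[OF measurable_fst this] measurable_compose[OF measurable_snd this]
      have "(\<lambda>p. (r (fst p), r (snd p))) \<in> measurable (borel \<Otimes>\<^sub>M borel) (M \<Otimes>\<^sub>M M)"
        using r by measurable
      then have "Measurable.pred (borel \<Otimes>\<^sub>M borel) (\<lambda>p. (r (fst p), r (snd p)) \<in> R)"
        using Rm by measurable
      then show ?thesis by (intro pred_intros_logic c)
    qed
    then have "P \<in> sets (borel \<Otimes>\<^sub>M borel)"
      unfolding P_def pred_def by (simp add: space_pair_measure)
    then have Pm: "P \<in> sets borel" by (simp only: borel_prod)
    have "countable {c'. (c, c') \<in> P}" for c
    proof (cases "{c'. (c, c') \<in> P} = {}")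
      case nonempty: False
      then have "r c \<in> space M" using RX unfolding P_def by auto
      then have "countable (R `` {r c})" using cnt unfolding countable_classes_def
        by (auto intro: quotientI)
      moreover have "{c'. (c, c') \<in> P} \<subseteq> e ` (R `` {r c})"
      proof
        fix c' assume "c' \<in> {c'. (c, c') \<in> P}"
        then have "c' = e (r c')" "(r c, r c') \<in> R" unfolding P_def by auto
        then show "c' \<in> e ` (R `` {r c})" by blast
      qed
      ultimately show ?thesis by (meson countable_image countable_subset)
    qed simp
    from lusin_novikov_cover[OF Pm this] obtain k :: "nat \<Rightarrow> (nat \<Rightarrow> nat) \<Rightarrow> nat \<Rightarrow> nat" where
      k: "\<And>n. k n \<in> borel_measurable borel" "\<And>x y. (x, y) \<in> P \<Longrightarrow> \<exists>n. y = k n x" by metis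
    show ?thesis
    proof (rule that[of "\<lambda>n x. r (k n (e x))"])
      show "(\<lambda>x. r (k n (e x))) \<in> measurable M M" for n
        by (rule measurable_compose[OF measurable_compose[OF e k(1)] r])
      show "\<exists>n. r (k n (e x)) = y" if xy: "(x, y) \<in> R" for x y
      proof -
        have "(e x, e y) \<in> P" unfolding P_def using RX[OF xy] re xy by simp
        then obtain n where "e y = k n (e x)" using k(2) by blast
        then show ?thesis using re[OF RX(2)[OF xy]] by metis
      qed
    qed
  qed
  \<comment> \<open>Where \<open>h n\<close> leaves \<open>R\<close> it is replaced by the identity.
    In \<open>F\<close> the index 0 is reserved for the identity, the future root map on
    \<open>D\<close>.\<close>
  define h' where "h' = (\<lambda>n x. if (x, h n x) \<in> R then h n x else x)"
  define F where "F = (\<lambda>n. case n of 0 \<Rightarrow> \<lambda>x. x | Suc n \<Rightarrow> h' n)"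
  have h'm: "h' n \<in> measurable M M" for n
    unfolding h'_def
  proof (rule measurable_If)
    have "(\<lambda>x. (x, h n x)) \<in> measurable M (M \<Otimes>\<^sub>M M)" using h(1)[of n] by measurable
    from measurable_sets[OF this Rm] show "{x \<in> space M. (x, h n x) \<in> R} \<in> sets M"
      by (simp add: vimage_def Int_def conj_commute)
  qed (use h(1) in auto)
  have F: "F n \<in> measurable M M" "x \<in> space M \<Longrightarrow> (x, F n x) \<in> R" for n x
    using h'm eqR unfolding F_def h'_def by (auto split: nat.split elim: equivE dest: refl_onD)
  have F0: "F 0 = (\<lambda>x. x)" by (simp add: F_def)
  have Fcov: "\<exists>n. F n x = y" if "(x, y) \<in> R" for x y
  proof -
    from h(2)[OF that] obtain n where "h n x = y" by blast
    then have "F (Suc n) x = y" using that by (simp add: F_def h'_def)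
    then show ?thesis by blast
  qed
  have d0: "prod_decode 0 = (0, 0)" by (simp add: prod_decode_def prod_decode_aux.simps)
  show ?thesis
  \<comment> \<open>One index codes a map together with a candidate inverse; the partial injection
    lives where the two match.\<close>
  proof (rule that[of "\<lambda>n. F (fst (prod_decode n))" "\<lambda>n. F (snd (prod_decode n))"])
    show "\<exists>n. F (fst (prod_decode n)) x = y \<and> F (snd (prod_decode n)) y = x" if xy: "(x, y) \<in> R" for x y
    proof -
      have "(y, x) \<in> R" using eqR xy by (meson equivE symE)
      then obtain a b where "F a x = y" "F b y = x" using Fcov xy by blast
      then show ?thesis by (intro exI[of _ "prod_encode (a, b)"]) simp
    qed
  qed (use F F0 d0 in auto)
qed

section \<open>Free families and cuts\<close>

text \<open>Minimal length also excludes chords. When the steps come from several equivalence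
  relations, consecutive steps then belong to different ones, since two in the same one would
  compose to a chord.\<close>

lemma shortest_path:
  assumes "(z, y) \<in> r\<^sup>*"
  obtains n p where "p 0 = z" "p n = y" "\<And>k. k < n \<Longrightarrow> (p k, p (Suc k)) \<in> r"
    "\<And>a b. a < b \<Longrightarrow> b \<le> n \<Longrightarrow> p a \<noteq> p b"
    "\<And>a b. Suc a < b \<Longrightarrow> b \<le> n \<Longrightarrow> (p a, p b) \<notin> r"
proof -
  define n where "n = (LEAST n. (z, y) \<in> r ^^ n)"
  have "(z, y) \<in> r ^^ n"
    unfolding n_def using rtrancl_imp_relpow[OF assms] by (rule LeastI_ex)
  then obtain p where p: "p 0 = z" "p n = y" "\<And>k. k < n \<Longrightarrow> (p k, p (Suc k)) \<in> r"
    by (auto simp: relpow_fun_conv)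
  have least: "n \<le> m" if "(z, y) \<in> r ^^ m" for m
    unfolding n_def using that by (rule Least_le)
  have start: "(z, p a) \<in> r ^^ a" if "a \<le> n" for a
    unfolding relpow_fun_conv using p that by (intro exI[of _ p]) auto
  have finish: "(p b, y) \<in> r ^^ (n - b)" if "b \<le> n" for b
    unfolding relpow_fun_conv using p that by (intro exI[of _ "\<lambda>k. p (b + k)"]) auto
  show ?thesis
  proof (rule that[OF p])
    fix a b assume ab: "a < b" "b \<le> n"
    show "p a \<noteq> p b"
    proof
      assume "p a = p b"
      then have "(z, y) \<in> r ^^ a O r ^^ (n - b)" using start[of a] finish[of b] ab by auto
      then have "n \<le> a + (n - b)" by (intro least) (simp add: relpow_add)
      with ab show False by simp
    qed
  next
    fix a b assume ab: "Suc a < b" "b \<le> n"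
    show "(p a, p b) \<notin> r"
    proof
      assume "(p a, p b) \<in> r"
      then have "(z, p b) \<in> r ^^ Suc a" using start[of a] ab by auto
      then have "(z, y) \<in> r ^^ Suc a O r ^^ (n - b)" using finish[of b] ab by blast
      then have "n \<le> Suc a + (n - b)" by (intro least) (simp only: relpow_add)
      with ab show False by simp
    qed
  qed simp_all
qed

text \<open>Removing the class of \<open>z0\<close> from the tree leaves one component for each of
  its points; \<open>U\<close> is the union of those hanging on \<open>Z\<close>. They are different
  by freeness: a path outside the class between two of its points would close up to a forbidden
  cycle.\<close>

lemma free_family_cut:
  assumes free: "free_family J F" and eqv: "\<And>j. j \<in> J \<Longrightarrow> equiv X (F j)"
    and i: "i \<in> J" and Z: "Z \<subseteq> F i `` {z0}"
  obtains U where "U \<inter> F i `` {z0} = Z"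
    "\<And>j a b. j \<in> J \<Longrightarrow> (a, b) \<in> F j \<Longrightarrow> \<not> (j = i \<and> (z0, a) \<in> F i) \<Longrightarrow> a \<in> U \<longleftrightarrow> b \<in> U"
proof -
  have symF: "(b, a) \<in> F j" if "j \<in> J" "(a, b) \<in> F j" for j a b
    using eqv[OF that(1)] that(2) by (meson equivE symE)
  have transF: "(a, c) \<in> F j" if "j \<in> J" "(a, b) \<in> F j" "(b, c) \<in> F j" for j a b c
    using eqv[OF that(1)] that(2,3) by (meson equivE transE)
  define r where "r = {(a, b). \<exists>j\<in>J. (a, b) \<in> F j \<and> \<not> (j = i \<and> (z0, a) \<in> F i)}"
  have key: "z = y" if zy: "(z, y) \<in> r\<^sup>*" "(z0, z) \<in> F i" "(z0, y) \<in> F i" for z y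
  proof (rule ccontr)
    assume "z \<noteq> y"
    obtain n p where p: "p 0 = z" "p n = y" "\<And>k. k < n \<Longrightarrow> (p k, p (Suc k)) \<in> r"
      "\<And>a b. a < b \<Longrightarrow> b \<le> n \<Longrightarrow> p a \<noteq> p b"
      "\<And>a b. Suc a < b \<Longrightarrow> b \<le> n \<Longrightarrow> (p a, p b) \<notin> r"
      by (rule shortest_path[OF zy(1)]) (rule that)
    have "\<forall>k. \<exists>j. k < n \<longrightarrow> j \<in> J \<and> (p k, p (Suc k)) \<in> F j \<and> \<not> (j = i \<and> (z0, p k) \<in> F i)"
      using p(3) unfolding r_def by blast
    then obtain j where j: "\<And>k. k < n \<Longrightarrow> j k \<in> J" "\<And>k. k < n \<Longrightarrow> (p k, p (Suc k)) \<in> F (j k)"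
      "\<And>k. k < n \<Longrightarrow> \<not> (j k = i \<and> (z0, p k) \<in> F i)" by metis
    have jneq: "j k \<noteq> j (Suc k)" if "Suc k < n" for k
    proof
      assume eq: "j k = j (Suc k)"
      have "(p k, p (Suc (Suc k))) \<in> F (j k)"
        using transF[OF j(1)[of k] j(2)[of k]] j(2)[of "Suc k"] that eq by (metis Suc_lessD)
      then have "(p k, p (Suc (Suc k))) \<in> r" unfolding r_def using j(1)[of k] j(3)[of k] that by auto
      with p(5)[of k "Suc (Suc k)"] that show False by simp
    qed
    have n0: "n > 0" using p(1,2) \<open>z \<noteq> y\<close> by (cases n) auto
    have jlast: "j (n - 1) \<noteq> i"
    proof
      assume eq: "j (n - 1) = i"
      have "(p (n - 1), y) \<in> F i" using j(2)[of "n - 1"] n0 eq p(2) by simp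
      then have "(z0, p (n - 1)) \<in> F i" using transF[OF i zy(3)] symF[OF i] by blast
      with j(3)[of "n - 1"] eq n0 show False by simp
    qed
    have yz: "(y, z) \<in> F i" using transF[OF i symF[OF i zy(3)] zy(2)] .
    \<comment> \<open>The cycle is the path, shifted by one, followed by a step back inside the
      class of \<open>z0\<close>; labels stay distinct there because the last step of the path is
      not taken in \<open>F i\<close>.\<close>
    define x where "x = (\<lambda>k. if k = n + 2 then z else p (k - 1))"
    define jj where "jj = (\<lambda>k. if k = n + 1 then i else j (k - 1))"
    have "\<exists>k\<in>{1..n + 2 - 1}. x k = x (k + 1)"
    proof (rule free[unfolded free_family_def, rule_format, of "n + 2" x jj], simp, intro conjI ballI)
      show "x (n + 2) = x 1" by (simp add: x_def p(1))
      fix k assume "k \<in> {1..n + 2 - 1}"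
      then consider "k = n + 1" | k' where "k = Suc k'" "k' < n" by (cases k) force+
      then show "jj k \<in> J" "(x k, x (k + 1)) \<in> F (jj k)"
        by (cases; use i j(1,2) yz p(2) in \<open>auto simp: jj_def x_def\<close>)+
    next
      fix k assume "k \<in> {1..n + 2 - 2}"
      then obtain k' where k': "k = Suc k'" "k' < n" by (cases k) auto
      show "jj k \<noteq> jj (k + 1)"
      proof (cases "Suc k' = n")
        case True
        then show ?thesis using k' jlast by (auto simp: jj_def)
      next
        case False
        then show ?thesis using k' jneq[of k'] by (simp add: jj_def)
      qed
    qed
    then obtain k where k: "k \<in> {1..n + 1}" "x k = x (k + 1)" by auto
    then consider "k = n + 1" | k' where "k = Suc k'" "k' < n" by (cases k) force+
    then show False
    proof cases
      case 1
      then show False using k(2) p(2) \<open>z \<noteq> y\<close> by (simp add: x_def)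
    next
      case 2
      then show False using k(2) p(4)[of k' "Suc k'"] by (simp add: x_def)
    qed
  qed
  have rsym: "(b, a) \<in> r" if ab: "(a, b) \<in> r" for a b
  proof -
    from ab obtain j where j: "j \<in> J" "(a, b) \<in> F j" "\<not> (j = i \<and> (z0, a) \<in> F i)"
      unfolding r_def by blast
    then have "\<not> (j = i \<and> (z0, b) \<in> F i)" using transF[OF i] symF by blast
    then show ?thesis unfolding r_def using j symF by blast
  qed
  show ?thesis
  proof (rule that[of "r\<^sup>* `` Z"])
    show "r\<^sup>* `` Z \<inter> F i `` {z0} = Z" using key Z by auto
    fix j a b assume "j \<in> J" "(a, b) \<in> F j" "\<not> (j = i \<and> (z0, a) \<in> F i)"
    then have "(a, b) \<in> r" unfolding r_def by blast
    then show "a \<in> r\<^sup>* `` Z \<longleftrightarrow> b \<in> r\<^sup>* `` Z"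
      using rsym by (meson ImageE ImageI rtrancl.rtrancl_into_rtrancl)
  qed
qed

text \<open>A cycle entering \<open>U\<close> by its first step can leave only from the point of
  entry and within the same factor. Consecutive factors differ, so it does not leave at once, and
  the part in between is a shorter cycle.\<close>

lemma free_family_if_cuts:
  assumes cut: "\<And>j a b. j \<in> J \<Longrightarrow> (a, b) \<in> F j \<Longrightarrow> a \<noteq> b \<Longrightarrow>
    \<exists>U. b \<in> U \<and> a \<notin> U \<and> (\<forall>k c d. k \<in> J \<longrightarrow> (c, d) \<in> F k \<longrightarrow> c \<in> U \<longrightarrow> d \<notin> U \<longrightarrow> k = j \<and> c = b)"
  shows "free_family J F"
proof -
  have "\<exists>k\<in>{1..n - 1}. x k = x (k + 1)"
    if "2 \<le> n" "x n = x 1" "\<forall>k\<in>{1..n - 1}. j k \<in> J \<and> (x k, x (k + 1)) \<in> F (j k)"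
      "\<forall>k\<in>{1..n - 2}. j k \<noteq> j (k + 1)" for n :: nat and x j
    using that
  proof (induction n arbitrary: x j rule: less_induct)
    case (less n)
    show ?case
    proof (rule ccontr)
      assume nt: "\<not> ?thesis"
      have n3: "n \<ge> 3"
      proof (rule ccontr)
        assume "\<not> n \<ge> 3"
        then have "n = 2" using less.prems(1) by simp
        then show False using nt less.prems(2) by (auto simp: numeral_2_eq_2)
      qed
      have "j 1 \<in> J" "(x 1, x 2) \<in> F (j 1)" using less.prems(3) n3 by (auto simp: numeral_2_eq_2)
      moreover have "x 1 \<noteq> x 2" using nt n3 by (auto simp: numeral_2_eq_2)
      ultimately obtain U where U: "x 2 \<in> U" "x 1 \<notin> U"
        "\<And>k c d. k \<in> J \<Longrightarrow> (c, d) \<in> F k \<Longrightarrow> c \<in> U \<Longrightarrow> d \<notin> U \<Longrightarrow> k = j 1 \<and> c = x 2"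
        using cut by metis
      define m where "m = (LEAST m. 2 \<le> m \<and> x (Suc m) \<notin> U)"
      have ex: "2 \<le> n - 1 \<and> x (Suc (n - 1)) \<notin> U" using n3 U(2) less.prems(2) by auto
      have m: "2 \<le> m" "x (Suc m) \<notin> U" "m \<le> n - 1"
        unfolding m_def using LeastI[of "\<lambda>m. 2 \<le> m \<and> x (Suc m) \<notin> U", OF ex] Least_le[of "\<lambda>m. 2 \<le> m \<and> x (Suc m) \<notin> U", OF ex] by auto
      have xm: "x m \<in> U"
      proof (cases "m = 2")
        case False
        then have "2 \<le> m - 1" "m - 1 < m" using m(1) by auto
        then have "x (Suc (m - 1)) \<in> U"
          using not_less_Least[of "m - 1" "\<lambda>m. 2 \<le> m \<and> x (Suc m) \<notin> U"] unfolding m_def by blast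
        then show ?thesis using m(1) by simp
      qed (simp add: U(1))
      have "j m \<in> J" "(x m, x (Suc m)) \<in> F (j m)" using less.prems(3) m by auto
      from U(3)[OF this xm m(2)] have jm: "j m = j 1" "x m = x 2" by auto
      have "1 \<in> {1..n - 2}" using n3 by auto
      then have "j 1 \<noteq> j (1 + 1)" using less.prems(4) by blast
      then have "m \<noteq> 2" using jm(1) by (auto simp: numeral_2_eq_2)
      then have m3: "m \<ge> 3" using m(1) by simp
      have "\<exists>k\<in>{1..m - 1 - 1}. x (Suc k) = x (Suc (k + 1))"
      proof (rule less.IH[of "m - 1" "\<lambda>k. x (Suc k)" "\<lambda>k. j (Suc k)"])
        show "m - 1 < n" "2 \<le> m - 1" using m m3 n3 by auto
        show "x (Suc (m - 1)) = x (Suc 1)" using jm(2) m3 by (simp add: numeral_2_eq_2)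
        show "\<forall>k\<in>{1..m - 1 - 1}. j (Suc k) \<in> J \<and> (x (Suc k), x (Suc (k + 1))) \<in> F (j (Suc k))"
          using less.prems(3) m by auto
        show "\<forall>k\<in>{1..m - 1 - 2}. j (Suc k) \<noteq> j (Suc (k + 1))"
          using less.prems(4) m by auto
      qed
      then obtain k where "k \<in> {1..m - 1 - 1}" "x (Suc k) = x (Suc (k + 1))" by blast
      then have "Suc k \<in> {1..n - 1}" "x (Suc k) = x (Suc k + 1)" using m by auto
      then show False using nt by blast
    qed
  qed
  then show ?thesis unfolding free_family_def by blast
qed

text \<open>The closing edge of the cycle is not met again, its at least three vertices being
  distinct; so the rest of the cycle never changes sides.\<close>

lemma acyclic_graph_if_cuts:
  assumes cut: "\<And>a b. (a, b) \<in> G \<Longrightarrow>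
    \<exists>U. (a \<in> U) \<noteq> (b \<in> U) \<and> (\<forall>c d. (c, d) \<in> G \<longrightarrow> (c \<in> U) \<noteq> (d \<in> U) \<longrightarrow> {c, d} = {a, b})"
  shows "acyclic_graph G"
  unfolding acyclic_graph_def
proof (intro notI, elim exE conjE)
  fix xs assume xs: "3 \<le> length xs" "distinct xs" "successively (\<lambda>x y. (x, y) \<in> G) xs" "(last xs, hd xs) \<in> G"
  from cut[OF xs(4)] obtain U where U: "(last xs \<in> U) \<noteq> (hd xs \<in> U)"
    "\<And>c d. (c, d) \<in> G \<Longrightarrow> (c \<in> U) \<noteq> (d \<in> U) \<Longrightarrow> {c, d} = {last xs, hd xs}" by blast
  have ne: "xs \<noteq> []" using xs(1) by auto
  have "k < length xs \<Longrightarrow> (xs ! k \<in> U) = (xs ! 0 \<in> U)" for k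
  proof (induction k)
    case (Suc k)
    have e: "(xs ! k, xs ! Suc k) \<in> G"
      using xs(3) Suc.prems by (simp add: successively_conv_nth)
    have "{xs ! k, xs ! Suc k} \<noteq> {last xs, hd xs}"
    proof
      assume "{xs ! k, xs ! Suc k} = {last xs, hd xs}"
      then have "{xs ! k, xs ! Suc k} = {xs ! (length xs - 1), xs ! 0}"
        using ne by (simp add: last_conv_nth hd_conv_nth)
      then have "xs ! Suc k = xs ! (length xs - 1)" "xs ! k = xs ! 0"
        using nth_eq_iff_index_eq[OF xs(2), of "Suc k" 0] Suc.prems ne by (auto simp: doubleton_eq_iff)
      then have "Suc k = length xs - 1" "k = 0"
        using nth_eq_iff_index_eq[OF xs(2)] Suc.prems ne by auto
      then show False using xs(1) by simp
    qed
    then show ?case using U(2)[OF e] Suc by auto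
  qed simp
  from this[of "length xs - 1"] U(1) ne show False
    by (simp add: last_conv_nth hd_conv_nth)
qed

text \<open>
  One class \<open>D\<close> of the subrelation inside a class \<open>C\<close> of the free product. The idea is to modify
  the Bass--Serre tree of \<open>C\<close>: every \<open>E i\<close>-class becomes a hub joined to its points of minimal
  rank (those with \<open>w i z = z\<close>), and any other point \<open>z\<close> is joined to \<open>w i z\<close>. The
  edges between \<open>z \<notin> D\<close> and its parent \<open>w (ip z) z\<close> form a forest rooted in \<open>D\<close>, and \<open>q\<close> contracts
  each of its trees to the root.
\<close>

locale class_contraction =
  fixes X C D :: "'a set" and I :: "'i set" and E :: "'i \<Rightarrow> 'a rel"
    and \<tau> :: "'a \<Rightarrow> nat" and w :: "'i \<Rightarrow> 'a \<Rightarrow> 'a" and q :: "'a \<Rightarrow> 'a" and ip :: "'a \<Rightarrow> 'i"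
  assumes free: "free_family I E" and eqv: "\<And>i. i \<in> I \<Longrightarrow> equiv X (E i)"
    and C_closed: "\<And>i z z'. i \<in> I \<Longrightarrow> z \<in> C \<Longrightarrow> (z, z') \<in> E i \<Longrightarrow> z' \<in> C"
    and w_rel: "\<And>i z. i \<in> I \<Longrightarrow> z \<in> C \<Longrightarrow> (z, w i z) \<in> E i"
    and w_idem: "\<And>i z. i \<in> I \<Longrightarrow> z \<in> C \<Longrightarrow> w i (w i z) = w i z"
    and ip: "\<And>z. z \<in> C \<Longrightarrow> z \<notin> D \<Longrightarrow> ip z \<in> I"
    and parent_less: "\<And>z. z \<in> C \<Longrightarrow> z \<notin> D \<Longrightarrow> \<tau> (w (ip z) z) < \<tau> z"
    and q_parent: "\<And>z. z \<in> C \<Longrightarrow> z \<notin> D \<Longrightarrow> q (w (ip z) z) = q z"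
    and q_root: "\<And>z. z \<in> D \<Longrightarrow> q z = z"
begin

text \<open>The edges at non-minimal points that survive the contraction, that is, all except those
  to the parent.\<close>

definition tree_edge :: "'i \<Rightarrow> 'a \<Rightarrow> bool" where
  "tree_edge i z \<longleftrightarrow> i \<in> I \<and> z \<in> C \<and> w i z \<noteq> z \<and> (z \<in> D \<or> i \<noteq> ip z)"

text \<open>A set crossed by no parent edge is a union of contracted trees, by induction along the
  ranks. The hypothesis \<open>par\<close> concerns the only class in which such an edge might
  cross.\<close>

lemma saturated_q:
  assumes i: "i \<in> I" and z0: "z0 \<in> C"
    and sat: "\<And>j a b. j \<in> I \<Longrightarrow> (a, b) \<in> E j \<Longrightarrow> \<not> (j = i \<and> (z0, a) \<in> E i) \<Longrightarrow> a \<in> U \<longleftrightarrow> b \<in> U"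
    and par: "\<And>z. z \<in> C \<Longrightarrow> (z0, z) \<in> E i \<Longrightarrow> z \<notin> D \<Longrightarrow> ip z = i \<Longrightarrow> z \<in> U \<longleftrightarrow> w i z \<in> U"
    and z: "z \<in> C"
  shows "q z \<in> U \<longleftrightarrow> z \<in> U"
  using z
proof (induction "\<tau> z" arbitrary: z rule: less_induct)
  case less
  show ?case
  proof (cases "z \<in> D")
    case False
    let ?p = "w (ip z) z"
    have "?p \<in> C" using C_closed[OF ip[OF less.prems False] less.prems w_rel[OF ip[OF less.prems False] less.prems]] .
    from less.hyps[OF parent_less[OF less.prems False] this]
    have "q z \<in> U \<longleftrightarrow> ?p \<in> U" using q_parent[OF less.prems False] by simp
    also have "\<dots> \<longleftrightarrow> z \<in> U"
      using sat[OF ip[OF less.prems False] w_rel[OF ip[OF less.prems False] less.prems]] par[OF less.prems] False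
      by blast
    finally show ?thesis .
  qed (simp add: q_root)
qed

text \<open>The edge between a hub and its neighbour \<open>z1\<close> is cut. The side of
  \<open>z1\<close> takes along the points of the class that are joined to \<open>z1\<close>, so no
  other edge of the modified tree is crossed.\<close>

lemma hub_cut:
  assumes i: "i \<in> I" and z1: "z1 \<in> C" "w i z1 = z1"
  obtains U where "z1 \<in> U" "\<And>z. z \<in> C \<Longrightarrow> q z \<in> U \<longleftrightarrow> z \<in> U"
    "\<And>j z. tree_edge j z \<Longrightarrow> z \<in> U \<longleftrightarrow> w j z \<in> U"
    "\<And>z. (z1, z) \<in> E i \<Longrightarrow> w i z = z \<Longrightarrow> z \<in> U \<Longrightarrow> z = z1"
    "\<And>j a b. j \<in> I \<Longrightarrow> (a, b) \<in> E j \<Longrightarrow> a \<in> U \<Longrightarrow> b \<notin> U \<Longrightarrow> j = i \<and> (z1, a) \<in> E i"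
proof -
  have z1E: "(z1, z1) \<in> E i" using w_rel[OF i z1(1)] z1(2) by simp
  obtain U where U: "U \<inter> E i `` {z1} = {z \<in> E i `` {z1}. w i z = z1}"
    "\<And>j a b. j \<in> I \<Longrightarrow> (a, b) \<in> E j \<Longrightarrow> \<not> (j = i \<and> (z1, a) \<in> E i) \<Longrightarrow> a \<in> U \<longleftrightarrow> b \<in> U"
    by (rule free_family_cut[OF free eqv i, of "{z \<in> E i `` {z1}. w i z = z1}" z1]) (auto intro: that)
  have inU: "z \<in> U \<longleftrightarrow> w i z = z1" if "(z1, z) \<in> E i" for z using U(1) that by blast
  have wU: "z \<in> U \<longleftrightarrow> w i z \<in> U" if z: "z \<in> C" "(z1, z) \<in> E i" for z
  proof -
    have "(z1, w i z) \<in> E i" using eqv[OF i] z(2) w_rel[OF i z(1)] by (meson equivE transE)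
    then show ?thesis using inU[OF z(2)] inU[of "w i z"] w_idem[OF i z(1)] by simp
  qed
  show ?thesis
  proof (rule that[of U])
    show "z1 \<in> U" using inU[OF z1E] z1(2) by simp
    show "q z \<in> U \<longleftrightarrow> z \<in> U" if "z \<in> C" for z
      by (rule saturated_q[OF i z1(1) U(2) wU that])
    show "z \<in> U \<longleftrightarrow> w j z \<in> U" if "tree_edge j z" for j z
      using U(2)[of j z "w j z"] wU[of z] w_rel[of j z] that unfolding tree_edge_def by blast
    show "z = z1" if "(z1, z) \<in> E i" "w i z = z" "z \<in> U" for z
      using inU[OF that(1)] that by simp
    show "j = i \<and> (z1, a) \<in> E i" if "j \<in> I" "(a, b) \<in> E j" "a \<in> U" "b \<notin> U" for j a b
      using U(2)[OF that(1,2)] that by blast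
  qed
qed

text \<open>The edge from \<open>z1\<close> to \<open>w i z1\<close> is cut. Being non-minimal,
  \<open>z1\<close> is no neighbour of the hub, so the minimal points of a class stay together; not
  leading to the parent, the edge survives the contraction.\<close>

lemma edge_cut:
  assumes e: "tree_edge i z1"
  obtains U where "z1 \<in> U" "w i z1 \<notin> U" "\<And>z. z \<in> C \<Longrightarrow> q z \<in> U \<longleftrightarrow> z \<in> U"
    "\<And>j z. tree_edge j z \<Longrightarrow> (z \<in> U) \<noteq> (w j z \<in> U) \<Longrightarrow> j = i \<and> z = z1"
    "\<And>j a b. j \<in> I \<Longrightarrow> (a, b) \<in> E j \<Longrightarrow> a \<in> C \<Longrightarrow> w j a = a \<Longrightarrow> w j b = b \<Longrightarrow> a \<in> U \<longleftrightarrow> b \<in> U"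
proof -
  have i: "i \<in> I" and z1: "z1 \<in> C" "w i z1 \<noteq> z1" and D: "z1 \<in> D \<or> i \<noteq> ip z1"
    using e unfolding tree_edge_def by auto
  have z1E: "(z1, z1) \<in> E i" using eqv[OF i] w_rel[OF i z1(1)] by (meson equivE symE transE)
  obtain U where U: "U \<inter> E i `` {z1} = {z1}"
    "\<And>j a b. j \<in> I \<Longrightarrow> (a, b) \<in> E j \<Longrightarrow> \<not> (j = i \<and> (z1, a) \<in> E i) \<Longrightarrow> a \<in> U \<longleftrightarrow> b \<in> U"
    by (rule free_family_cut[OF free eqv i, of "{z1}" z1]) (use z1E in \<open>auto intro: that\<close>)
  have inU: "z \<in> U \<longleftrightarrow> z = z1" if "(z1, z) \<in> E i" for z using U(1) that by blast
  have wE: "(z1, w i z) \<in> E i" if "(z1, z) \<in> E i" "z \<in> C" for z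
    using eqv[OF i] that w_rel[OF i that(2)] by (meson equivE transE)
  have wU: "w i z \<notin> U" if z: "z \<in> C" "(z1, z) \<in> E i" for z
    using inU[OF wE[OF z(2,1)]] w_idem[OF i z(1)] z1(2) by metis
  show ?thesis
  proof (rule that[of U])
    show "z1 \<in> U" using inU[OF z1E] by simp
    show "w i z1 \<notin> U" using wU[OF z1(1) z1E] .
    show "q z \<in> U \<longleftrightarrow> z \<in> U" if "z \<in> C" for z
    proof (rule saturated_q[OF i z1(1) U(2) _ that])
      fix z assume z: "z \<in> C" "(z1, z) \<in> E i" "z \<notin> D" "ip z = i"
      then show "z \<in> U \<longleftrightarrow> w i z \<in> U" using inU[OF z(2)] wU[OF z(1,2)] D by auto
    qed
    show "j = i \<and> z = z1" if jz: "tree_edge j z" "(z \<in> U) \<noteq> (w j z \<in> U)" for j z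
    proof -
      have "j \<in> I" "z \<in> C" using jz(1) unfolding tree_edge_def by auto
      then have "j = i \<and> (z1, z) \<in> E i" using U(2)[OF _ w_rel] jz(2) by blast
      then show ?thesis using wU[OF \<open>z \<in> C\<close>] inU jz(2) by blast
    qed
    show "a \<in> U \<longleftrightarrow> b \<in> U" if ab: "j \<in> I" "(a, b) \<in> E j" "a \<in> C" "w j a = a" "w j b = b" for j a b
    proof (cases "j = i \<and> (z1, a) \<in> E i")
      case True
      then have "(z1, b) \<in> E i" using eqv[OF i] ab(2) by (meson equivE transE)
      then show ?thesis using inU True ab z1(2) by metis
    qed (use U(2)[OF ab(1,2)] in blast)
  qed
qed

end

section \<open>The decomposition of the subrelation\<close>

text \<open>A stage codes a quadruple. Its first component is arbitrary and lets each choice of the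
  other three recur at arbitrarily late stages.\<close>

definition stage_factor :: "'i set \<Rightarrow> nat \<Rightarrow> 'i" where
  "stage_factor I t = from_nat_into I (fst (prod_decode (snd (prod_decode t))))"

definition stage_parent :: "nat \<Rightarrow> nat" where
  "stage_parent t = fst (prod_decode (snd (prod_decode (snd (prod_decode t)))))"

definition stage_root :: "nat \<Rightarrow> nat" where
  "stage_root t = snd (prod_decode (snd (prod_decode (snd (prod_decode t)))))"

lemma stage_recurs:
  assumes "countable I" "i \<in> I"
  obtains t where "t0 \<le> t" "stage_factor I t = i" "stage_parent t = k" "stage_root t = n"
proof -
  obtain a where "from_nat_into I a = i" using from_nat_into_surj[OF assms] by blast
  then show ?thesis
    using that[of "prod_encode (t0, prod_encode (a, prod_encode (k, n)))"] le_prod_encode_1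
    by (simp add: stage_factor_def stage_parent_def stage_root_def)
qed

text \<open>Stage \<open>t\<close> assigns rank \<open>Suc t\<close>; rank 0 belongs to the points
  of \<open>D\<close>, whose root map is the identity \<open>f 0\<close>.\<close>

definition root_index :: "nat \<Rightarrow> nat" where
  "root_index s = (case s of 0 \<Rightarrow> 0 | Suc t \<Rightarrow> stage_root t)"

lemma root_index_simps [simp]: "root_index 0 = 0" "root_index (Suc t) = stage_root t"
  by (simp_all add: root_index_def)

lemma equiv_dest:
  assumes "equiv A Q"
  shows "\<And>x. x \<in> A \<Longrightarrow> (x, x) \<in> Q" "\<And>x y. (x, y) \<in> Q \<Longrightarrow> (y, x) \<in> Q"
    "\<And>x y z. (x, y) \<in> Q \<Longrightarrow> (y, z) \<in> Q \<Longrightarrow> (x, z) \<in> Q"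
    "\<And>x y. (x, y) \<in> Q \<Longrightarrow> x \<in> A" "\<And>x y. (x, y) \<in> Q \<Longrightarrow> y \<in> A"
  using assms by (auto elim!: equivE dest: refl_onD symD transD)

text \<open>
  For a fixed \<open>x\<close>, the points \<open>z\<close> of the \<open>R\<close>-class of \<open>x\<close> are attached one after the other to the
  \<open>S\<close>-class \<open>D\<close> of \<open>x\<close>; \<open>rank x z\<close> is the time of attachment (0 on \<open>D\<close>). Stage \<open>t\<close> codes a factor
  \<open>i\<close> and numbers \<open>k\<close>, \<open>n\<close>, and attaches those \<open>z\<close> whose prospective parent \<open>f k z\<close> is an
  already attached point of minimal rank of the \<open>Ri i\<close>-class of \<open>z\<close> and whose root in \<open>D\<close>, inherited
  from the parent, is \<open>f n z\<close>. Everything depends on \<open>x\<close> only through \<open>D\<close>, and the rank of \<open>z\<close>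
  determines the index \<open>n\<close> with which its root is reached; so points of equal rank have distinct
  roots.
\<close>

locale kurosh_setting =
  fixes M :: "'a measure" and R :: "'a rel" and I :: "'i set" and Ri :: "'i \<Rightarrow> 'a rel"
    and S :: "'a rel" and f g :: "nat \<Rightarrow> 'a \<Rightarrow> 'a"
  assumes R_sets: "R \<in> sets (M \<Otimes>\<^sub>M M)" and R_equiv: "equiv (space M) R"
    and I_countable: "countable I"
    and Ri_sets: "\<And>i. i \<in> I \<Longrightarrow> Ri i \<in> sets (M \<Otimes>\<^sub>M M)"
    and Ri_equiv: "\<And>i. i \<in> I \<Longrightarrow> equiv (space M) (Ri i)"
    and R_generated: "generated_by (space M) R I Ri"
    and Ri_free: "free_family I Ri"
    and S_sets: "S \<in> sets (M \<Otimes>\<^sub>M M)" and S_equiv: "equiv (space M) S" and S_R: "S \<subseteq> R"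
    and diagonal: "Measurable.pred (M \<Otimes>\<^sub>M M) (\<lambda>p. fst p = snd p)"
    and f_measurable: "\<And>n. f n \<in> measurable M M" and g_measurable: "\<And>n. g n \<in> measurable M M"
    and f_0: "f 0 = (\<lambda>x. x)" and g_0: "g 0 = (\<lambda>x. x)"
    and f_R: "\<And>n x. x \<in> space M \<Longrightarrow> (x, f n x) \<in> R"
    and g_R: "\<And>n x. x \<in> space M \<Longrightarrow> (x, g n x) \<in> R"
    and f_cover: "\<And>x y. (x, y) \<in> R \<Longrightarrow> \<exists>n. f n x = y \<and> g n y = x"
begin

lemmas R_refl = equiv_dest(1)[OF R_equiv] and R_sym = equiv_dest(2)[OF R_equiv]
  and R_trans = equiv_dest(3)[OF R_equiv]
  and R_space = equiv_dest(4)[OF R_equiv] equiv_dest(5)[OF R_equiv]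
lemmas S_refl = equiv_dest(1)[OF S_equiv] and S_sym = equiv_dest(2)[OF S_equiv]
  and S_trans = equiv_dest(3)[OF S_equiv]
  and S_space = equiv_dest(4)[OF S_equiv] equiv_dest(5)[OF S_equiv]
lemmas Ri_refl = equiv_dest(1)[OF Ri_equiv] and Ri_sym = equiv_dest(2)[OF Ri_equiv]
  and Ri_trans = equiv_dest(3)[OF Ri_equiv]

lemma S_imp_R: "(x, y) \<in> S \<Longrightarrow> (x, y) \<in> R"
  using S_R by blast

lemma Ri_imp_R: "i \<in> I \<Longrightarrow> (x, y) \<in> Ri i \<Longrightarrow> (x, y) \<in> R"
  using R_generated unfolding generated_by_def by blast

lemma Ri_cover:
  assumes "i \<in> I" "(z, y) \<in> Ri i"
  obtains m where "y = f m z"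
  using f_cover[OF Ri_imp_R[OF assms]] by blast

section \<open>Attaching the points of a class to \<open>D\<close>\<close>

definition attachable :: "nat \<Rightarrow> ('a \<Rightarrow> nat option) \<Rightarrow> 'a \<Rightarrow> bool" where
  "attachable t e z \<longleftrightarrow> stage_factor I t \<in> I \<and>
     (z, f (stage_parent t) z) \<in> Ri (stage_factor I t) \<and>
     g (stage_root t) (f (stage_root t) z) = z \<and>
     (\<exists>s. e (f (stage_parent t) z) = Some s \<and>
        f (root_index s) (f (stage_parent t) z) = f (stage_root t) z \<and>
        (\<forall>m s'. (z, f m z) \<in> Ri (stage_factor I t) \<longrightarrow> e (f m z) = Some s' \<longrightarrow> s \<le> s'))"

primrec attached :: "nat \<Rightarrow> 'a \<Rightarrow> 'a \<Rightarrow> nat option" where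
  "attached 0 x z = (if (x, z) \<in> S then Some 0 else None)"
| "attached (Suc t) x z = (case attached t x z of Some s \<Rightarrow> Some s
     | None \<Rightarrow> if attachable t (attached t x) z then Some (Suc t) else None)"

definition rank :: "'a \<Rightarrow> 'a \<Rightarrow> nat" where
  "rank x z = (LEAST t. attached t x z \<noteq> None)"

definition minimal :: "'i \<Rightarrow> 'a \<Rightarrow> 'a \<Rightarrow> bool" where
  "minimal i x z \<longleftrightarrow> (\<forall>m. (z, f m z) \<in> Ri i \<longrightarrow> rank x z \<le> rank x (f m z))"

text \<open>A point attached through the factor \<open>i\<close> is joined to its parent, so that
  parent edges are edges of the modified tree. Otherwise the least index is a Borel choice, and it
  is 0 at a minimal point.\<close>

definition toward_index :: "'i \<Rightarrow> 'a \<Rightarrow> 'a \<Rightarrow> nat" where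
  "toward_index i x z = (if rank x z \<noteq> 0 \<and> stage_factor I (rank x z - 1) = i
     then stage_parent (rank x z - 1)
     else LEAST m. (z, f m z) \<in> Ri i \<and> minimal i x (f m z))"

definition toward :: "'i \<Rightarrow> 'a \<Rightarrow> 'a \<Rightarrow> 'a" where
  "toward i x z = f (toward_index i x z) z"

definition root :: "'a \<Rightarrow> 'a \<Rightarrow> 'a" where
  "root x z = f (root_index (rank x z)) z"

lemma attached_mono:
  assumes "attached t x z = Some s" "t \<le> t'"
  shows "attached t' x z = Some s"
  using assms(2,1) by (induction t' rule: dec_induct) auto

lemma attached_label:
  "attached t x z = Some s \<Longrightarrow> s \<le> t \<and> attached s x z = Some s"
proof (induction t)
  case 0
  then show ?case by (auto split: if_splits)
next
  case (Suc t)
  show ?case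
  proof (cases "attached t x z")
    case None
    then have "s = Suc t" using Suc.prems by (auto split: if_splits)
    then show ?thesis using Suc.prems by simp
  next
    case (Some s')
    then show ?thesis using Suc by auto
  qed
qed

lemma rank_eq:
  assumes "attached t x z = Some s"
  shows "rank x z = s"
  unfolding rank_def
proof (rule Least_equality)
  show "attached s x z \<noteq> None" using attached_label[OF assms] by simp
  fix t' assume "attached t' x z \<noteq> None"
  then obtain s' where s': "attached t' x z = Some s'" by blast
  have "attached (max t t') x z = Some s" "attached (max t t') x z = Some s'"
    by (rule attached_mono[OF assms] attached_mono[OF s'], simp)+
  then show "s \<le> t'" using attached_label[OF s'] by simp
qed

context
  fixes x x' assumes xx': "(x, x') \<in> S"
begin

lemma attached_cong: "attached t x = attached t x'"
proof (induction t)
  case 0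
  have "(x, z) \<in> S \<longleftrightarrow> (x', z) \<in> S" for z using xx' S_sym S_trans by blast
  then show ?case by (intro ext) simp
next
  case (Suc t)
  show ?case by (rule ext) (simp add: Suc)
qed

lemma rank_cong: "rank x = rank x'"
  by (rule ext) (simp add: rank_def attached_cong)

lemma minimal_cong: "minimal i x = minimal i x'"
  by (rule ext) (simp add: minimal_def rank_cong)

lemma toward_cong: "toward i x = toward i x'"
  by (rule ext) (simp add: toward_def toward_index_def rank_cong minimal_cong)

lemma root_cong: "root x = root x'"
  by (rule ext) (simp add: root_def rank_cong)

end

text \<open>Some attached point of the class has least rank. A sufficiently late stage codes it as
  the parent, together with the right root index, and attaches \<open>z\<close> unless this has
  happened before.\<close>

lemma attached_step:
  assumes j: "j \<in> I" and zz': "(z, z') \<in> Ri j" and z': "attached t' x z' = Some s'"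
  shows "\<exists>t s. attached t x z = Some s"
proof -
  have "\<exists>y. ((z, y) \<in> Ri j \<and> (\<exists>t s. attached t x y = Some s)) \<and>
     (\<forall>y'. (z, y') \<in> Ri j \<and> (\<exists>t s. attached t x y' = Some s) \<longrightarrow> rank x y \<le> rank x y')"
    using zz' z' by (intro ex_has_least_nat[where k = z']) blast
  then obtain y t1 s where y: "(z, y) \<in> Ri j" "attached t1 x y = Some s"
    "\<And>y' t s'. (z, y') \<in> Ri j \<Longrightarrow> attached t x y' = Some s' \<Longrightarrow> rank x y \<le> rank x y'" by blast
  obtain k where k: "f k z = y" using f_cover[OF Ri_imp_R[OF j y(1)]] by blast
  have "(z, f (root_index s) y) \<in> R"
    using R_trans[OF Ri_imp_R[OF j y(1)]] f_R R_space(2)[OF Ri_imp_R[OF j y(1)]] by blast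
  then obtain n where n: "f n z = f (root_index s) y" "g n (f n z) = z" using f_cover by metis
  obtain t where t: "t1 \<le> t" "stage_factor I t = j" "stage_parent t = k" "stage_root t = n"
    by (rule stage_recurs[OF I_countable j]) (rule that)
  show ?thesis
  proof (cases "attached t x z")
    case None
    have "attached t x y = Some s" by (rule attached_mono[OF y(2) t(1)])
    moreover have "s \<le> s'" if "(z, f m z) \<in> Ri j" "attached t x (f m z) = Some s'" for m s'
      using y(3)[OF that] rank_eq[OF y(2)] rank_eq[OF that(2)] by simp
    ultimately have "attachable t (attached t x) z"
      unfolding attachable_def t(2,3,4) using j k y(1) n by auto
    then show ?thesis using None by (intro exI[of _ "Suc t"]) auto
  qed blast
qed

text \<open>The attached points form a set invariant under every \<open>Ri j\<close>; agreeing on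
  membership in it is an equivalence relation, which therefore contains \<open>R\<close>.\<close>

lemma all_attached:
  assumes "(x, z) \<in> R"
  obtains t s where "attached t x z = Some s"
proof -
  define A where "A = {z. \<exists>t s. attached t x z = Some s}"
  define Q where "Q = {(z, z'). z \<in> space M \<and> z' \<in> space M \<and> (z \<in> A \<longleftrightarrow> z' \<in> A)}"
  have "equiv (space M) Q"
    unfolding Q_def by (intro equivI refl_onI symI transI) auto
  moreover have "Ri j \<subseteq> Q" if j: "j \<in> I" for j
  proof clarify
    fix a b assume ab: "(a, b) \<in> Ri j"
    then show "(a, b) \<in> Q"
      using attached_step[OF j ab] attached_step[OF j Ri_sym[OF j ab]] R_space[OF Ri_imp_R[OF j ab]]
      unfolding Q_def A_def by blast
  qed
  ultimately have "R \<subseteq> Q" using R_generated unfolding generated_by_def by blast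
  then have "(x, z) \<in> Q" using assms by blast
  moreover have "x \<in> A"
    unfolding A_def using S_refl[OF R_space(1)[OF assms]] by (auto intro: exI[of _ 0])
  ultimately show ?thesis using that unfolding Q_def A_def by blast
qed

lemma attached_rank:
  assumes "(x, z) \<in> R"
  shows "attached (rank x z) x z = Some (rank x z)"
  using all_attached[OF assms] attached_label rank_eq by metis

lemma rank_0_iff:
  assumes "(x, z) \<in> R"
  shows "rank x z = 0 \<longleftrightarrow> (x, z) \<in> S"
proof
  assume "rank x z = 0"
  then have "attached 0 x z = Some 0" using attached_rank[OF assms] by simp
  then show "(x, z) \<in> S" by (simp split: if_splits)
next
  assume "(x, z) \<in> S"
  then show "rank x z = 0" by (intro rank_eq[of 0]) simp
qed

text \<open>At stage \<open>t\<close> the parent is compared only with points attached so far, but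
  later ones receive a rank above \<open>t\<close>; so it has least rank in its whole class.\<close>

lemma rank_Suc:
  assumes z: "(x, z) \<in> R" and t: "rank x z = Suc t"
  defines "i \<equiv> stage_factor I t" and "p \<equiv> f (stage_parent t) z"
  shows "i \<in> I" "(z, p) \<in> Ri i" "g (stage_root t) (f (stage_root t) z) = z"
    "rank x p < rank x z" "root x p = root x z" "\<And>y. (z, y) \<in> Ri i \<Longrightarrow> rank x p \<le> rank x y"
proof -
  have a: "attached (Suc t) x z = Some (Suc t)" using attached_rank[OF z] t by simp
  have "attached t x z = None"
    using attached_label[of t x z] a rank_eq[of t x z] t by (cases "attached t x z") fastforce+
  with a have "attachable t (attached t x) z" by (auto split: if_splits)
  then obtain s where s: "i \<in> I" "(z, p) \<in> Ri i" "g (stage_root t) (f (stage_root t) z) = z"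
    "attached t x p = Some s" "f (root_index s) p = f (stage_root t) z"
    "\<And>m s'. (z, f m z) \<in> Ri i \<Longrightarrow> attached t x (f m z) = Some s' \<Longrightarrow> s \<le> s'"
    unfolding attachable_def i_def p_def by blast
  have rp: "rank x p = s" "s \<le> t" using rank_eq[OF s(4)] attached_label[OF s(4)] by auto
  show "i \<in> I" "(z, p) \<in> Ri i" "g (stage_root t) (f (stage_root t) z) = z" by fact+
  show "rank x p < rank x z" using rp t by simp
  show "root x p = root x z" unfolding root_def rp(1) t by (simp add: s(5))
  fix y assume y: "(z, y) \<in> Ri i"
  obtain m where m: "y = f m z" by (rule Ri_cover[OF s(1) y])
  show "rank x p \<le> rank x y"
  proof (cases "attached t x y")
    case (Some s')
    then show ?thesis using s(6)[of m s'] y rank_eq[OF Some] rp m by simp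
  next
    case None
    have "(x, y) \<in> R" using R_trans[OF z Ri_imp_R[OF s(1) y]] .
    from attached_rank[OF this] None attached_mono[of "rank x y" x y "rank x y" t]
    have "\<not> rank x y \<le> t" by auto
    then show ?thesis using rp by simp
  qed
qed

lemma minimal_iff:
  assumes "i \<in> I"
  shows "minimal i x z \<longleftrightarrow> (\<forall>y. (z, y) \<in> Ri i \<longrightarrow> rank x z \<le> rank x y)"
  unfolding minimal_def using Ri_cover[OF assms] by metis

lemma toward_minimal:
  assumes i: "i \<in> I" and z: "(x, z) \<in> R"
  shows "(z, toward i x z) \<in> Ri i \<and> minimal i x (toward i x z)"
proof (cases "rank x z \<noteq> 0 \<and> stage_factor I (rank x z - 1) = i")
  case True
  then obtain t where t: "rank x z = Suc t" "stage_factor I t = i" by (cases "rank x z") auto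
  note s = rank_Suc[OF z t(1), unfolded t(2)]
  have eq: "toward i x z = f (stage_parent t) z"
    using t by (simp add: toward_def toward_index_def)
  show ?thesis unfolding eq
    using s(2) s(6) Ri_trans[OF i] by (auto simp: minimal_iff[OF i])
next
  case False
  have "(z, z) \<in> Ri i" using Ri_refl[OF i R_space(2)[OF z]] .
  then have "\<exists>y. (z, y) \<in> Ri i \<and> (\<forall>y'. (z, y') \<in> Ri i \<longrightarrow> rank x y \<le> rank x y')"
    by (rule ex_has_least_nat)
  then obtain y where y: "(z, y) \<in> Ri i" "\<And>y'. (z, y') \<in> Ri i \<Longrightarrow> rank x y \<le> rank x y'" by blast
  obtain m where "y = f m z" by (rule Ri_cover[OF i y(1)])
  moreover have "minimal i x y" unfolding minimal_iff[OF i] using y Ri_trans[OF i] by blast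
  ultimately have ex: "\<exists>m. (z, f m z) \<in> Ri i \<and> minimal i x (f m z)" using y(1) by blast
  show ?thesis
    unfolding toward_def toward_index_def if_not_P[OF False] by (rule LeastI_ex[OF ex])
qed

text \<open>A minimal point has no parent in this class, as a parent has smaller rank; the least
  index is then that of the identity.\<close>

lemma toward_id_iff:
  assumes i: "i \<in> I" and z: "(x, z) \<in> R"
  shows "toward i x z = z \<longleftrightarrow> minimal i x z"
proof
  assume "toward i x z = z"
  then show "minimal i x z" using toward_minimal[OF i z] by simp
next
  assume m: "minimal i x z"
  have not_parent: "\<not> (rank x z \<noteq> 0 \<and> stage_factor I (rank x z - 1) = i)"
  proof
    assume "rank x z \<noteq> 0 \<and> stage_factor I (rank x z - 1) = i"
    then obtain t where t: "rank x z = Suc t" "stage_factor I t = i" by (cases "rank x z") auto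
    note s = rank_Suc[OF z t(1), unfolded t(2)]
    show False using m s(2,4) unfolding minimal_iff[OF i] by force
  qed
  have "(LEAST m. (z, f m z) \<in> Ri i \<and> minimal i x (f m z)) = 0"
    using m Ri_refl[OF i R_space(2)[OF z]] by (intro Least_eq_0) (simp add: f_0)
  then show "toward i x z = z"
    unfolding toward_def toward_index_def if_not_P[OF not_parent] by (simp add: f_0)
qed

lemma g_root:
  assumes z: "(x, z) \<in> R"
  shows "g (root_index (rank x z)) (root x z) = z"
proof (cases "rank x z")
  case (Suc t)
  then show ?thesis using rank_Suc(3)[OF z Suc] by (simp add: root_def)
qed (simp add: root_def f_0 g_0)

lemma root_S: "(x, z) \<in> R \<Longrightarrow> (x, root x z) \<in> S"
proof (induction "rank x z" arbitrary: z rule: less_induct)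
  case less
  show ?case
  proof (cases "rank x z")
    case 0
    then show ?thesis using rank_0_iff[OF less.prems] by (simp add: root_def f_0)
  next
    case (Suc t)
    note s = rank_Suc[OF less.prems Suc]
    show ?thesis using less.hyps[OF s(4) R_trans[OF less.prems Ri_imp_R[OF s(1,2)]]] s(5) by simp
  qed
qed

lemma root_id: "(x, z) \<in> S \<Longrightarrow> root x z = z"
  using rank_0_iff[OF S_imp_R] by (simp add: root_def f_0)

lemma class_contraction:
  "class_contraction (space M) (R `` {x}) (S `` {x}) I Ri (rank x) (\<lambda>i. toward i x) (root x)
     (\<lambda>z. stage_factor I (rank x z - 1))"
proof
  show "free_family I Ri" by (rule Ri_free)
  show "equiv (space M) (Ri i)" if "i \<in> I" for i by (rule Ri_equiv[OF that])
  show "z' \<in> R `` {x}" if "i \<in> I" "z \<in> R `` {x}" "(z, z') \<in> Ri i" for i z z'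
    using that R_trans Ri_imp_R by blast
  fix i z assume i: "i \<in> I" and z: "z \<in> R `` {x}"
  then have xz: "(x, z) \<in> R" by simp
  note t = toward_minimal[OF i xz]
  show "(z, toward i x z) \<in> Ri i" using t by simp
  show "toward i x (toward i x z) = toward i x z"
    using t toward_id_iff[OF i R_trans[OF xz Ri_imp_R[OF i]]] by blast
next
  fix z assume "z \<in> R `` {x}" "z \<notin> S `` {x}"
  then have z: "(x, z) \<in> R" "(x, z) \<notin> S" by simp_all
  then obtain t where t: "rank x z = Suc t" using rank_0_iff by (cases "rank x z") auto
  note s = rank_Suc[OF z(1) t]
  have p: "toward (stage_factor I t) x z = f (stage_parent t) z"
    using t by (simp add: toward_def toward_index_def)
  show "stage_factor I (rank x z - 1) \<in> I" using s(1) t by simp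
  show "rank x (toward (stage_factor I (rank x z - 1)) x z) < rank x z" using s(4) t p by simp
  show "root x (toward (stage_factor I (rank x z - 1)) x z) = root x z" using s(5) t p by simp
next
  show "root x z = z" if "z \<in> S `` {x}" for z using that root_id by simp
qed

section \<open>The conjugated factors and the graph of the tree part\<close>

definition conj_dom :: "'i \<Rightarrow> nat \<Rightarrow> 'a set" where
  "conj_dom i s = {a \<in> space M. f (root_index s) (g (root_index s) a) = a \<and>
     rank a (g (root_index s) a) = s \<and> minimal i a (g (root_index s) a)}"

text \<open>The minimal points of an \<open>Ri i\<close>-class share one rank \<open>s\<close>, so
  ranks can index the factors: a class of \<open>conj_rel i s\<close> is the set of roots of the
  neighbours of one hub, and \<open>g (root_index s)\<close> leads from the roots back to these
  points.\<close>

definition conj_rel :: "'i \<Rightarrow> nat \<Rightarrow> 'a rel" where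
  "conj_rel i s = {(a, b) \<in> S. a \<in> conj_dom i s \<and> b \<in> conj_dom i s \<and>
     (g (root_index s) a, g (root_index s) b) \<in> Ri i}"

definition tree_edge :: "'a \<Rightarrow> 'i \<Rightarrow> 'a \<Rightarrow> bool" where
  "tree_edge x i z \<longleftrightarrow> i \<in> I \<and> (x, z) \<in> R \<and> toward i x z \<noteq> z \<and>
     ((x, z) \<in> S \<or> i \<noteq> stage_factor I (rank x z - 1))"

text \<open>All data depend on the base point only through its \<open>S\<close>-class, so the
  endpoint \<open>a\<close> can serve as base point.\<close>

definition tree_edges :: "'a rel" where
  "tree_edges = {(a, b). \<exists>i z. tree_edge a i z \<and> root a z = a \<and> b = root a (toward i a z)}"

definition tree_graph :: "'a rel" where
  "tree_graph = tree_edges \<union> tree_edges\<inverse>"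

definition tree_rel :: "'a rel" where
  "tree_rel = {(a, b). a \<in> space M \<and> b \<in> space M \<and> (a, b) \<in> tree_graph\<^sup>*}"

lemma tree_edge_cong: "(x, x') \<in> S \<Longrightarrow> tree_edge x i z \<longleftrightarrow> tree_edge x' i z"
  unfolding tree_edge_def using rank_cong toward_cong S_sym S_trans R_trans S_imp_R by metis

lemma tree_edge_class: "class_contraction.tree_edge (R `` {x}) (S `` {x}) I (\<lambda>i. toward i x)
    (\<lambda>z. stage_factor I (rank x z - 1)) i z \<longleftrightarrow> tree_edge x i z"
  unfolding class_contraction.tree_edge_def[OF class_contraction] tree_edge_def by auto

lemma tree_edgeD:
  assumes "tree_edge x i z"
  shows "i \<in> I" "(x, z) \<in> R" "(x, toward i x z) \<in> R" "(x, root x z) \<in> S" "(x, root x (toward i x z)) \<in> S"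
proof -
  show iz: "i \<in> I" "(x, z) \<in> R" using assms unfolding tree_edge_def by auto
  show t: "(x, toward i x z) \<in> R" using toward_minimal[OF iz] R_trans[OF iz(2) Ri_imp_R[OF iz(1)]] by blast
  show "(x, root x z) \<in> S" "(x, root x (toward i x z)) \<in> S" using root_S iz(2) t by auto
qed

lemma tree_edges_S: "tree_edges \<subseteq> S"
  unfolding tree_edges_def using tree_edgeD(5) by auto

lemma tree_graph_S: "tree_graph \<subseteq> S"
  unfolding tree_graph_def using tree_edges_S S_sym by blast

lemma sym_tree_graph: "sym tree_graph"
  unfolding tree_graph_def by (auto intro: symI)

lemma tree_graph_rtrancl_S: "(a, b) \<in> tree_graph\<^sup>* \<Longrightarrow> a \<in> space M \<Longrightarrow> (a, b) \<in> S"
  by (induction rule: rtrancl_induct) (use S_refl S_trans tree_graph_S in blast)+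

lemma tree_rel_S: "tree_rel \<subseteq> S"
  unfolding tree_rel_def using tree_graph_rtrancl_S by auto

lemma tree_rel_equiv: "equiv (space M) tree_rel"
proof (rule equivI)
  show "refl_on (space M) tree_rel" unfolding tree_rel_def by (auto intro!: refl_onI)
  show "sym tree_rel" unfolding tree_rel_def
    using sym_rtrancl[OF sym_tree_graph] by (auto intro!: symI dest: symD)
  show "trans tree_rel" unfolding tree_rel_def by (auto intro!: transI)
  show "tree_rel \<subseteq> space M \<times> space M" unfolding tree_rel_def by auto
qed

text \<open>Moves an edge to an arbitrary base point \<open>x\<close> of the class; the clause with
  \<open>V\<close> transfers a crossing without recording the orientation.\<close>

lemma tree_graphE:
  assumes "(a, b) \<in> tree_graph" "(x, a) \<in> S"
  obtains i z where "tree_edge x i z" "{a, b} = {root x z, root x (toward i x z)}"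
    "(a \<in> V) \<noteq> (b \<in> V) \<longleftrightarrow> (root x z \<in> V) \<noteq> (root x (toward i x z) \<in> V)"
proof -
  consider "(a, b) \<in> tree_edges" | "(b, a) \<in> tree_edges"
    using assms(1) unfolding tree_graph_def by blast
  then show ?thesis
  proof cases
    case 1
    then obtain i z where "tree_edge a i z" "root a z = a" "b = root a (toward i a z)"
      unfolding tree_edges_def by auto
    then show ?thesis
      using that[of i z] tree_edge_cong[OF assms(2)] root_cong[OF assms(2)] toward_cong[OF assms(2)] by auto
  next
    case 2
    have xb: "(x, b) \<in> S" using tree_edges_S 2 S_sym S_trans assms(2) by blast
    from 2 obtain i z where "tree_edge b i z" "root b z = b" "a = root b (toward i b z)"
      unfolding tree_edges_def by auto
    then show ?thesis
      using that[of i z] tree_edge_cong[OF xb] root_cong[OF xb] toward_cong[OF xb] by auto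
  qed
qed

section \<open>Cuts of the decomposition and its freeness\<close>

lemma conj_relD:
  assumes i: "i \<in> I" and ab: "(a, b) \<in> conj_rel i s" and xa: "(x, a) \<in> S"
  obtains z z' where "(z, z') \<in> Ri i" "(x, z) \<in> R" "(x, z') \<in> R" "toward i x z = z" "toward i x z' = z'"
    "root x z = a" "root x z' = b" "rank x z = s" "rank x z' = s"
proof -
  let ?n = "root_index s"
  have xb: "(x, b) \<in> S" using ab xa S_trans unfolding conj_rel_def by blast
  have "(x, g ?n a) \<in> R" "(x, g ?n b) \<in> R"
    using R_trans[OF S_imp_R[OF xa] g_R] R_trans[OF S_imp_R[OF xb] g_R] S_space xa xb by blast+
  then show ?thesis
    using that[of "g ?n a" "g ?n b"] ab toward_id_iff[OF i]
    unfolding conj_rel_def conj_dom_def root_def rank_cong[OF xa] rank_cong[OF xb] minimal_cong[OF xa]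
      minimal_cong[OF xb]
    by (auto simp: rank_cong[OF xa, symmetric] rank_cong[OF xb, symmetric]
       minimal_cong[OF xa, symmetric] minimal_cong[OF xb, symmetric])
qed

text \<open>The hub cut never separates a point from its root, so a step between roots crosses it
  exactly when the step between the points above them does; of these only the hub edge at
  \<open>z'\<close>, the point above \<open>b\<close>, crosses.\<close>

lemma conj_rel_cut:
  assumes i: "i \<in> I" and ab: "(a, b) \<in> conj_rel i s" "a \<noteq> b"
  obtains U where "b \<in> U" "a \<notin> U" "\<And>c d. (c, d) \<in> tree_graph \<Longrightarrow> c \<in> U \<longleftrightarrow> d \<in> U"
    "\<And>j t c d. j \<in> I \<Longrightarrow> (c, d) \<in> conj_rel j t \<Longrightarrow> c \<in> U \<Longrightarrow> d \<notin> U \<Longrightarrow> j = i \<and> t = s \<and> c = b"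
proof -
  have aS: "(a, a) \<in> S" "(a, b) \<in> S" using ab S_refl S_space unfolding conj_rel_def by blast+
  obtain z z' where z: "(z, z') \<in> Ri i" "(a, z) \<in> R" "(a, z') \<in> R" "toward i a z = z" "toward i a z' = z'"
    "root a z = a" "root a z' = b" "rank a z = s" "rank a z' = s"
    by (rule conj_relD[OF i ab(1) aS(1)]) (rule that)
  have z': "z' \<in> R `` {a}" using z(3) by simp
  obtain V where V: "z' \<in> V" "\<And>z. z \<in> R `` {a} \<Longrightarrow> root a z \<in> V \<longleftrightarrow> z \<in> V"
    "\<And>j z. tree_edge a j z \<Longrightarrow> z \<in> V \<longleftrightarrow> toward j a z \<in> V"
    "\<And>z. (z', z) \<in> Ri i \<Longrightarrow> toward i a z = z \<Longrightarrow> z \<in> V \<Longrightarrow> z = z'"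
    "\<And>j c d. j \<in> I \<Longrightarrow> (c, d) \<in> Ri j \<Longrightarrow> c \<in> V \<Longrightarrow> d \<notin> V \<Longrightarrow> j = i \<and> (z', c) \<in> Ri i"
    by (rule class_contraction.hub_cut[OF class_contraction i z' z(5), unfolded tree_edge_class]) (rule that)
  show ?thesis
  proof (rule that[of "V \<inter> S `` {a}"])
    show "b \<in> V \<inter> S `` {a}" using V(1) V(2)[OF z'] z(7) aS by simp
    have "z \<notin> V" using V(4)[OF Ri_sym[OF i z(1)] z(4)] z(6,7) ab(2) by auto
    then show "a \<notin> V \<inter> S `` {a}" using V(2)[of z] z(2,6) by auto
  next
    fix c d assume cd: "(c, d) \<in> tree_graph"
    have S_iff: "(a, c) \<in> S \<longleftrightarrow> (a, d) \<in> S" using cd tree_graph_S S_sym S_trans by blast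
    have "c \<in> V \<longleftrightarrow> d \<in> V" if ac: "(a, c) \<in> S"
    proof -
      obtain j y where y: "tree_edge a j y"
        "(c \<in> V) \<noteq> (d \<in> V) \<longleftrightarrow> (root a y \<in> V) \<noteq> (root a (toward j a y) \<in> V)"
        by (rule tree_graphE[OF cd ac]) (rule that)
      show ?thesis using y(2) V(3)[OF y(1)] V(2) tree_edgeD(2,3)[OF y(1)] by blast
    qed
    with S_iff show "c \<in> V \<inter> S `` {a} \<longleftrightarrow> d \<in> V \<inter> S `` {a}" by blast
  next
    fix j t c d assume j: "j \<in> I" and cd: "(c, d) \<in> conj_rel j t"
      and c: "c \<in> V \<inter> S `` {a}" and d: "d \<notin> V \<inter> S `` {a}"
    have ac: "(a, c) \<in> S" using c by simp
    have ad: "(a, d) \<in> S" using S_trans[OF ac] cd unfolding conj_rel_def by blast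
    obtain y y' where y: "(y, y') \<in> Ri j" "(a, y) \<in> R" "(a, y') \<in> R" "toward j a y = y"
      "toward j a y' = y'" "root a y = c" "root a y' = d" "rank a y = t" "rank a y' = t"
      by (rule conj_relD[OF j cd ac]) (rule that)
    have yV: "y \<in> V" "y' \<notin> V" using V(2)[of y] V(2)[of y'] y c d ad by auto
    have ji: "j = i" "(z', y) \<in> Ri i" using V(5)[OF j y(1) yV] by auto
    then have "y = z'" using V(4)[OF ji(2)] y(4) yV(1) by simp
    then show "j = i \<and> t = s \<and> c = b" using ji(1) y z by simp
  qed
qed

lemma tree_graph_cut:
  assumes ab: "(a, b) \<in> tree_graph"
  obtains U where "(a \<in> U) \<noteq> (b \<in> U)"
    "\<And>c d. (c, d) \<in> tree_graph \<Longrightarrow> (c \<in> U) \<noteq> (d \<in> U) \<Longrightarrow> {c, d} = {a, b}"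
    "\<And>j t c d. j \<in> I \<Longrightarrow> (c, d) \<in> conj_rel j t \<Longrightarrow> c \<in> U \<longleftrightarrow> d \<in> U"
proof -
  have aS: "(a, a) \<in> S" "(a, b) \<in> S" using ab tree_graph_S S_refl S_space by blast+
  obtain i z where z: "tree_edge a i z" "{a, b} = {root a z, root a (toward i a z)}"
    by (rule tree_graphE[OF ab aS(1)]) (rule that)
  obtain V where V: "z \<in> V" "toward i a z \<notin> V" "\<And>z. z \<in> R `` {a} \<Longrightarrow> root a z \<in> V \<longleftrightarrow> z \<in> V"
    "\<And>j y. tree_edge a j y \<Longrightarrow> (y \<in> V) \<noteq> (toward j a y \<in> V) \<Longrightarrow> j = i \<and> y = z"
    "\<And>j c d. j \<in> I \<Longrightarrow> (c, d) \<in> Ri j \<Longrightarrow> c \<in> R `` {a} \<Longrightarrow> toward j a c = c \<Longrightarrow> toward j a d = d \<Longrightarrow> c \<in> V \<longleftrightarrow> d \<in> V"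
    by (rule class_contraction.edge_cut[OF class_contraction[of a], unfolded tree_edge_class, OF z(1)])
       (rule that)
  have rV: "root a y \<in> V \<longleftrightarrow> y \<in> V" if "(a, y) \<in> R" for y using V(3) that by simp
  show ?thesis
  proof (rule that[of "V \<inter> S `` {a}"])
    have "(root a z \<in> V) \<noteq> (root a (toward i a z) \<in> V)"
      using rV[OF tree_edgeD(2)[OF z(1)]] rV[OF tree_edgeD(3)[OF z(1)]] V(1,2) by simp
    then have "(a \<in> V) \<noteq> (b \<in> V)" using z(2) by (auto simp: doubleton_eq_iff)
    then show "(a \<in> V \<inter> S `` {a}) \<noteq> (b \<in> V \<inter> S `` {a})" using aS by simp
  next
    fix c d assume cd: "(c, d) \<in> tree_graph" "(c \<in> V \<inter> S `` {a}) \<noteq> (d \<in> V \<inter> S `` {a})"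
    have "(a, c) \<in> S \<longleftrightarrow> (a, d) \<in> S" using cd(1) tree_graph_S S_sym S_trans by blast
    then have ac: "(a, c) \<in> S" "(c \<in> V) \<noteq> (d \<in> V)" using cd(2) by auto
    obtain j y where y: "tree_edge a j y" "{c, d} = {root a y, root a (toward j a y)}"
      "(c \<in> V) \<noteq> (d \<in> V) \<longleftrightarrow> (root a y \<in> V) \<noteq> (root a (toward j a y) \<in> V)"
      by (rule tree_graphE[OF cd(1) ac(1)]) (rule that)
    have "(y \<in> V) \<noteq> (toward j a y \<in> V)"
      using y(3) ac(2) rV[OF tree_edgeD(2)[OF y(1)]] rV[OF tree_edgeD(3)[OF y(1)]] by simp
    then have "j = i \<and> y = z" by (rule V(4)[OF y(1)])
    then show "{c, d} = {a, b}" using y(2) z(2) by simp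
  next
    fix j t c d assume j: "j \<in> I" and cd: "(c, d) \<in> conj_rel j t"
    have S_iff: "(a, c) \<in> S \<longleftrightarrow> (a, d) \<in> S" using cd S_sym S_trans unfolding conj_rel_def by blast
    have "c \<in> V \<longleftrightarrow> d \<in> V" if ac: "(a, c) \<in> S"
    proof -
      obtain y y' where y: "(y, y') \<in> Ri j" "(a, y) \<in> R" "(a, y') \<in> R" "toward j a y = y"
        "toward j a y' = y'" "root a y = c" "root a y' = d"
        by (rule conj_relD[OF j cd ac]) (rule that)
      show ?thesis using V(5)[OF j y(1) _ y(4,5)] rV y(2,3,6,7) by auto
    qed
    with S_iff show "c \<in> V \<inter> S `` {a} \<longleftrightarrow> d \<in> V \<inter> S `` {a}" by blast
  qed
qed

text \<open>The cut at an edge has its endpoints on different sides, so the contraction creates no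
  loop.\<close>

lemma tree_graph_irrefl: "tree_graph \<inter> Id = {}"
proof -
  have "a \<noteq> b" if "(a, b) \<in> tree_graph" for a b
    by (rule tree_graph_cut[OF that]) auto
  then show ?thesis by auto
qed

lemma tree_graph_acyclic: "acyclic_graph tree_graph"
proof (rule acyclic_graph_if_cuts)
  fix a b assume "(a, b) \<in> tree_graph"
  then show "\<exists>U. (a \<in> U) \<noteq> (b \<in> U) \<and>
    (\<forall>c d. (c, d) \<in> tree_graph \<longrightarrow> (c \<in> U) \<noteq> (d \<in> U) \<longrightarrow> {c, d} = {a, b})"
    by (rule tree_graph_cut) blast
qed

definition fam :: "('i \<times> nat) option \<Rightarrow> 'a rel" where
  "fam = kurosh_family M conj_dom conj_rel tree_rel"

definition ix :: "('i \<times> nat) option set" where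
  "ix = kurosh_index I (\<lambda>_. UNIV)"

lemma ix_cases:
  assumes "p \<in> ix"
  obtains "p = None" | i s where "p = Some (i, s)" "i \<in> I"
  using assms unfolding ix_def kurosh_index_def by auto

lemma fam_None [simp]: "fam None = tree_rel"
  by (simp add: fam_def kurosh_family_def)

lemma fam_SomeD: "(a, b) \<in> fam (Some (i, s)) \<Longrightarrow> a = b \<or> (a, b) \<in> conj_rel i s"
  by (auto simp: fam_def kurosh_family_def extend_by_equality_def)

text \<open>The cut is at the first edge of a shortest path from \<open>b\<close> to
  \<open>c\<close>. The path does not return to \<open>b\<close>, hence not to this edge, and the
  other components of the graph do not contain it.\<close>

lemma tree_cut:
  assumes bc: "(b, c) \<in> tree_graph\<^sup>*" "b \<noteq> c" and b: "b \<in> space M"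
  obtains U where "(b \<in> U) \<noteq> (c \<in> U)"
    "\<And>p d e. p \<in> ix \<Longrightarrow> (d, e) \<in> fam p \<Longrightarrow> \<not> (p = None \<and> (b, d) \<in> tree_rel) \<Longrightarrow> d \<in> U \<longleftrightarrow> e \<in> U"
proof -
  obtain n p where p: "p 0 = b" "p n = c" "\<And>k. k < n \<Longrightarrow> (p k, p (Suc k)) \<in> tree_graph"
    "\<And>k l. k < l \<Longrightarrow> l \<le> n \<Longrightarrow> p k \<noteq> p l"
    by (rule shortest_path[OF bc(1)]) (rule that)
  have n: "n > 0" using p(1,2) bc(2) by (cases n) auto
  have bp: "(b, p 1) \<in> tree_graph" using p(3)[OF n] p(1) by simp
  obtain U where U: "(b \<in> U) \<noteq> (p 1 \<in> U)"
    "\<And>c d. (c, d) \<in> tree_graph \<Longrightarrow> (c \<in> U) \<noteq> (d \<in> U) \<Longrightarrow> {c, d} = {b, p 1}"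
    "\<And>j t c d. j \<in> I \<Longrightarrow> (c, d) \<in> conj_rel j t \<Longrightarrow> c \<in> U \<longleftrightarrow> d \<in> U"
    by (rule tree_graph_cut[OF bp]) (rule that)
  have "k < n \<Longrightarrow> p (Suc k) \<in> U \<longleftrightarrow> p 1 \<in> U" for k
  proof (induction k)
    case (Suc k)
    have "p (Suc k) \<noteq> b" "p (Suc (Suc k)) \<noteq> b"
      using p(4)[of 0 "Suc k"] p(4)[of 0 "Suc (Suc k)"] p(1) Suc.prems by auto
    then have "b \<notin> {p (Suc k), p (Suc (Suc k))}" by simp
    then have "{p (Suc k), p (Suc (Suc k))} \<noteq> {b, p 1}" by blast
    then show ?case using U(2)[OF p(3)[OF Suc.prems]] Suc by auto
  qed simp
  from this[of "n - 1"] n p(2) have "c \<in> U \<longleftrightarrow> p 1 \<in> U" by simp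
  show ?thesis
  proof (rule that[of U])
    show "(b \<in> U) \<noteq> (c \<in> U)" using U(1) \<open>c \<in> U \<longleftrightarrow> p 1 \<in> U\<close> by simp
    fix k d e assume k: "k \<in> ix" "(d, e) \<in> fam k" "\<not> (k = None \<and> (b, d) \<in> tree_rel)"
    from k(1) show "d \<in> U \<longleftrightarrow> e \<in> U"
    proof (cases rule: ix_cases)
      case 1
      then have de: "(d, e) \<in> tree_graph\<^sup>*" "d \<in> space M" "(b, d) \<notin> tree_rel"
        using k by (auto simp: tree_rel_def)
      have nbd: "(b, d) \<notin> tree_graph\<^sup>*" using de b unfolding tree_rel_def by auto
      have sym: "(y, x) \<in> tree_graph\<^sup>*" if "(x, y) \<in> tree_graph\<^sup>*" for x y
        using sym_rtrancl[OF sym_tree_graph] that by (auto dest: symD)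
      from de(1) show ?thesis
      proof (induction rule: rtrancl_induct)
        case (step y y')
        have "y \<noteq> b" "y \<noteq> p 1"
          using sym[OF step.hyps(1)] nbd bp by (auto intro: converse_rtrancl_into_rtrancl)
        then have "y \<notin> {b, p 1}" by simp
        then have "{y, y'} \<noteq> {b, p 1}" by blast
        then show ?case using U(2)[OF step.hyps(2)] step.IH by auto
      qed simp
    next
      case (2 i s)
      then show ?thesis using fam_SomeD[of d e i s] k(2) U(3) by auto
    qed
  qed
qed

theorem fam_free: "free_family ix fam"
proof (rule free_family_if_cuts)
  fix j a b assume j: "j \<in> ix" and ab: "(a, b) \<in> fam j" "a \<noteq> b"
  from j show "\<exists>U. b \<in> U \<and> a \<notin> U \<and>
    (\<forall>k c d. k \<in> ix \<longrightarrow> (c, d) \<in> fam k \<longrightarrow> c \<in> U \<longrightarrow> d \<notin> U \<longrightarrow> k = j \<and> c = b)"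
  proof (cases rule: ix_cases)
    case (2 i s)
    then have abS: "(a, b) \<in> conj_rel i s" using fam_SomeD ab by blast
    obtain U where U: "b \<in> U" "a \<notin> U" "\<And>c d. (c, d) \<in> tree_graph \<Longrightarrow> c \<in> U \<longleftrightarrow> d \<in> U"
      "\<And>j t c d. j \<in> I \<Longrightarrow> (c, d) \<in> conj_rel j t \<Longrightarrow> c \<in> U \<Longrightarrow> d \<notin> U \<Longrightarrow> j = i \<and> t = s \<and> c = b"
      by (rule conj_rel_cut[OF 2(2) abS ab(2)]) (rule that)
    have "k = j \<and> c = b" if k: "k \<in> ix" "(c, d) \<in> fam k" "c \<in> U" "d \<notin> U" for k c d
      using k(1)
    proof (cases rule: ix_cases)
      case 1
      then have "(c, d) \<in> tree_graph\<^sup>*" using k(2) by (simp add: tree_rel_def)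
      then have "c \<in> U \<longleftrightarrow> d \<in> U" by (induction rule: rtrancl_induct) (use U(3) in auto)
      then show ?thesis using k by simp
    next
      case (2 i' s')
      then have "(c, d) \<in> conj_rel i' s'" using fam_SomeD k by blast
      from U(4)[OF 2(2) this k(3,4)] show ?thesis using 2 \<open>j = Some (i, s)\<close> by simp
    qed
    then show ?thesis using U(1,2) by blast
  next
    case 1
    have abT: "(a, b) \<in> tree_rel" using ab 1 by simp
    have b: "b \<in> space M" using abT by (simp add: tree_rel_def)
    note T = equiv_dest[OF tree_rel_equiv]
    \<comment> \<open>A tree class may have many edges at \<open>b\<close>, so the cut at one edge
      is not enough. The set reached from \<open>b\<close> without steps inside its tree class meets
      that class in \<open>b\<close> alone, because \<open>tree_cut\<close> separates
      \<open>b\<close> from every other point.\<close>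
    define r where "r = {(c, d). \<exists>k\<in>ix. (c, d) \<in> fam k \<and> \<not> (k = None \<and> (b, c) \<in> tree_rel)}"
    have key: "c = b" if c: "(b, c) \<in> r\<^sup>*" "(b, c) \<in> tree_rel" for c
    proof (rule ccontr)
      assume "c \<noteq> b"
      then have bc: "(b, c) \<in> tree_graph\<^sup>*" "b \<noteq> c" using c(2) by (auto simp: tree_rel_def)
      obtain U where U: "(b \<in> U) \<noteq> (c \<in> U)"
        "\<And>p d e. p \<in> ix \<Longrightarrow> (d, e) \<in> fam p \<Longrightarrow> \<not> (p = None \<and> (b, d) \<in> tree_rel) \<Longrightarrow> d \<in> U \<longleftrightarrow> e \<in> U"
        by (rule tree_cut[OF bc b]) (rule that)
      from c(1) have "b \<in> U \<longleftrightarrow> c \<in> U"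
      proof (induction rule: rtrancl_induct)
        case (step y y')
        then show ?case using U(2) unfolding r_def by blast
      qed simp
      with U(1) show False by simp
    qed
    have "k = j \<and> c = b" if k: "k \<in> ix" "(c, d) \<in> fam k" "c \<in> r\<^sup>* `` {b}" "d \<notin> r\<^sup>* `` {b}" for k c d
    proof -
      have "(c, d) \<notin> r" using k(3,4) by (auto intro: rtrancl_into_rtrancl)
      then have "k = None \<and> (b, c) \<in> tree_rel" using k(1,2) unfolding r_def by blast
      then show ?thesis using key[of c] k(3) 1 by simp
    qed
    moreover have "a \<notin> r\<^sup>* `` {b}" using key[of a] ab(2) T(2)[OF abT] by auto
    ultimately show ?thesis by (intro exI[of _ "r\<^sup>* `` {b}"]) blast
  qed
qed

section \<open>Generation of \<open>S\<close> by the factors\<close>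

lemma conj_rel_S: "conj_rel i s \<subseteq> S"
  unfolding conj_rel_def by blast

lemma fam_S:
  assumes "p \<in> ix" shows "fam p \<subseteq> S"
  using assms
proof (cases rule: ix_cases)
  case (2 i s)
  then show ?thesis
    using conj_rel_S S_refl by (auto simp: fam_def kurosh_family_def extend_by_equality_def)
qed (use tree_rel_S in simp)

lemma root_minimal_conj_rel:
  assumes i: "i \<in> I" and zz': "(x, z) \<in> R" "(z, z') \<in> Ri i" and m: "minimal i x z" "minimal i x z'"
  shows "(root x z, root x z') \<in> conj_rel i (rank x z)"
proof -
  have xz': "(x, z') \<in> R" using R_trans[OF zz'(1) Ri_imp_R[OF i zz'(2)]] .
  have eq: "rank x z' = rank x z"
    using m zz'(2) Ri_sym[OF i zz'(2)] unfolding minimal_iff[OF i] by (metis le_antisym)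
  have S: "(x, root x z) \<in> S" "(x, root x z') \<in> S" using root_S zz'(1) xz' by auto
  note cong = rank_cong[OF S(1), symmetric] rank_cong[OF S(2), symmetric]
    minimal_cong[OF S(1), symmetric] minimal_cong[OF S(2), symmetric]
  have g: "g (root_index (rank x z)) (root x z) = z" "g (root_index (rank x z)) (root x z') = z'"
    using g_root[OF zz'(1)] g_root[OF xz'] eq by auto
  have f: "f (root_index (rank x z)) z = root x z" "f (root_index (rank x z)) z' = root x z'"
    using eq by (simp_all add: root_def)
  have "(root x z, root x z') \<in> S" using S S_sym S_trans by blast
  then show ?thesis
    unfolding conj_rel_def conj_dom_def using S_space(2)[OF S(1)] S_space(2)[OF S(2)]
    by (simp add: g f m eq zz'(2) cong)
qed

theorem fam_generated: "generated_by (space M) S ix fam"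
  unfolding generated_by_def
proof (intro conjI ballI allI impI S_equiv fam_S)
  fix Q assume "equiv (space M) Q \<and> (\<forall>j\<in>ix. fam j \<subseteq> Q)"
  then have Q: "equiv (space M) Q" and famQ: "\<And>j. j \<in> ix \<Longrightarrow> fam j \<subseteq> Q" by auto
  note Qd = equiv_dest[OF Q]
  have conjQ: "conj_rel i s \<subseteq> Q" if "i \<in> I" for i s
    using famQ[of "Some (i, s)"] that
    by (auto simp: ix_def kurosh_index_def fam_def kurosh_family_def extend_by_equality_def)
  have treeQ: "(c, d) \<in> Q" if "(c, d) \<in> tree_edges" for c d
  proof -
    have "(c, d) \<in> tree_rel"
      using that S_space tree_edges_S unfolding tree_rel_def tree_graph_def by blast
    then show ?thesis using famQ[of None] by (auto simp: ix_def kurosh_index_def)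
  qed
  show "S \<subseteq> Q"
  proof clarify
    fix x y assume xy: "(x, y) \<in> S"
    \<comment> \<open>The step to the minimal point is an edge of the graph, or leads to the parent
      and keeps the root, or is trivial.\<close>
    have towardQ: "(root x z, root x (toward i x z)) \<in> Q" if i: "i \<in> I" and z: "(x, z) \<in> R" for i z
    proof (cases "tree_edge x i z")
      case True
      have S: "(x, root x z) \<in> S" using root_S[OF z] .
      have "root x (root x z) = root x z" using root_id[OF S] .
      then have "(root x z, root x (toward i x z)) \<in> tree_edges"
        unfolding tree_edges_def
        using True tree_edge_cong[OF S] root_cong[OF S] toward_cong[OF S] by auto
      then show ?thesis by (rule treeQ)
    next
      case False
      have "root x (toward i x z) = root x z"
      proof (cases "toward i x z = z")
        case neq: False
        then have "(x, z) \<notin> S" "i = stage_factor I (rank x z - 1)"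
          using False i z unfolding tree_edge_def by auto
        then show ?thesis
          using class_contraction.q_parent[OF class_contraction, of z x] z by simp
      qed simp
      then show ?thesis using Qd(1) S_space(2)[OF root_S[OF z]] by simp
    qed
    \<comment> \<open>Membership in the class of \<open>x\<close> is built in, so that
      \<open>E\<close> is an equivalence relation on the whole space and \<open>R\<close> can be
      compared with it as the smallest one.\<close>
    define E where "E = {(z, z'). z \<in> space M \<and> z' \<in> space M \<and> ((x, z) \<in> R \<longleftrightarrow> (x, z') \<in> R) \<and>
      ((x, z) \<in> R \<longrightarrow> (root x z, root x z') \<in> Q)}"
    have "equiv (space M) E"
    proof (rule equivI)
      show "refl_on (space M) E"
        unfolding E_def using Qd(1) S_space(2)[OF root_S] by (auto intro!: refl_onI)
      show "sym E" unfolding E_def using Qd(2) by (auto intro!: symI)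
      show "trans E" unfolding E_def using Qd(3) by (blast intro!: transI)
      show "E \<subseteq> space M \<times> space M" unfolding E_def by auto
    qed
    moreover have "Ri i \<subseteq> E" if i: "i \<in> I" for i
    proof clarify
      fix z z' assume zz': "(z, z') \<in> Ri i"
      have R: "(z, z') \<in> R" using Ri_imp_R[OF i zz'] .
      have "(root x z, root x z') \<in> Q" if xz: "(x, z) \<in> R"
      proof -
        have xz': "(x, z') \<in> R" using R_trans[OF xz R] .
        note t = toward_minimal[OF i xz] and t' = toward_minimal[OF i xz']
        \<comment> \<open>The step from \<open>z\<close> to \<open>z'\<close> is replaced by a
          detour through two minimal points, whose middle part passes through the hub.\<close>
        have "(toward i x z, toward i x z') \<in> Ri i"
          using t t' zz' Ri_sym[OF i] Ri_trans[OF i] by blast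
        moreover have "(x, toward i x z) \<in> R" using R_trans[OF xz Ri_imp_R[OF i]] t by blast
        ultimately have "(root x (toward i x z), root x (toward i x z')) \<in> conj_rel i (rank x (toward i x z))"
          using root_minimal_conj_rel[OF i] t t' by blast
        then have "(root x (toward i x z), root x (toward i x z')) \<in> Q" using conjQ[OF i] by blast
        then show ?thesis using towardQ[OF i xz] towardQ[OF i xz'] Qd(2,3) by blast
      qed
      then show "(z, z') \<in> E"
        unfolding E_def using R_space[OF R] R R_sym R_trans by blast
    qed
    ultimately have "R \<subseteq> E" using R_generated unfolding generated_by_def by blast
    then have "(x, y) \<in> E" using S_imp_R[OF xy] by blast
    then have "(root x x, root x y) \<in> Q" unfolding E_def using R_refl S_space(1)[OF xy] by blast
    then show "(x, y) \<in> Q" using root_id[OF xy] root_id[OF S_refl[OF S_space(1)[OF xy]]] by simp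
  qed
qed

section \<open>Borel measurability of the construction\<close>

lemma eq_pred:
  assumes "a \<in> measurable N M" "b \<in> measurable N M"
  shows "Measurable.pred N (\<lambda>p. a p = b p)"
  using measurable_compose[OF measurable_Pair[OF assms] diagonal] by simp

lemma in_pred:
  assumes "Q \<in> sets (M \<Otimes>\<^sub>M M)" "a \<in> measurable N M" "b \<in> measurable N M"
  shows "Measurable.pred N (\<lambda>p. (a p, b p) \<in> Q)"
  using measurable_compose[OF measurable_Pair[OF assms(2,3)] pred_sets2[OF assms(1) measurable_ident]] by simp

lemma f_snd: "(\<lambda>p. f m (snd p)) \<in> measurable (M \<Otimes>\<^sub>M M) M"
  by (rule measurable_compose[OF measurable_snd f_measurable])

lemma Ri_pred: "i \<in> I \<Longrightarrow> Measurable.pred (M \<Otimes>\<^sub>M M) (\<lambda>p. (snd p, f m (snd p)) \<in> Ri i)"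
  by (rule in_pred[OF Ri_sets measurable_snd f_snd])

lemma attachable_measurable:
  assumes e: "(\<lambda>p. e (fst p) (snd p)) \<in> measurable (M \<Otimes>\<^sub>M M) (count_space UNIV)"
  shows "Measurable.pred (M \<Otimes>\<^sub>M M) (\<lambda>p. attachable t (e (fst p)) (snd p))"
proof (cases "stage_factor I t \<in> I")
  case False
  then show ?thesis by (simp add: attachable_def)
next
  case True
  have ef: "(\<lambda>p. e (fst p) (f m (snd p))) \<in> measurable (M \<Otimes>\<^sub>M M) (count_space UNIV)" for m
    using measurable_compose[OF measurable_Pair[OF measurable_fst f_snd] e] by simp
  have es: "Measurable.pred (M \<Otimes>\<^sub>M M) (\<lambda>p. e (fst p) (f m (snd p)) = Some s)" for m s
    by (rule pred_eq_const1[OF ef]) simp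
  have ff: "(\<lambda>p. h (f m (snd p))) \<in> measurable (M \<Otimes>\<^sub>M M) M" if "h \<in> measurable M M" for m h
    by (rule measurable_compose[OF f_snd that])
  show ?thesis
    unfolding attachable_def
    by (intro pred_intros_logic pred_intros_countable es Ri_pred[OF True]
        eq_pred[OF ff[OF g_measurable] measurable_snd] eq_pred[OF ff[OF f_measurable] f_snd])
      (simp_all add: True)
qed

lemma attached_measurable:
  "(\<lambda>p. attached t (fst p) (snd p)) \<in> measurable (M \<Otimes>\<^sub>M M) (count_space UNIV)"
proof (induction t)
  case 0
  have "Measurable.pred (M \<Otimes>\<^sub>M M) (\<lambda>p. (fst p, snd p) \<in> S)"
    by (rule in_pred[OF S_sets measurable_fst measurable_snd])
  then show ?case unfolding attached.simps by (intro measurable_If measurable_const) (auto simp: pred_def)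
next
  case (Suc t)
  have eq: "(\<lambda>p. attached (Suc t) (fst p) (snd p)) =
      (\<lambda>p. if attached t (fst p) (snd p) = None
           then if attachable t (attached t (fst p)) (snd p) then Some (Suc t) else None
           else attached t (fst p) (snd p))"
    by (auto split: option.split)
  have "Measurable.pred (M \<Otimes>\<^sub>M M) (\<lambda>p. attached t (fst p) (snd p) = None)"
    by (rule pred_eq_const1[OF Suc]) simp
  moreover note attachable_measurable[OF Suc, of t]
  ultimately show ?case
    unfolding eq by (intro measurable_If measurable_const Suc) (auto simp: pred_def)
qed

lemma rank_measurable: "(\<lambda>p. rank (fst p) (snd p)) \<in> measurable (M \<Otimes>\<^sub>M M) (count_space UNIV)"
  unfolding rank_def
proof (rule measurable_Least)
  show "Measurable.pred (M \<Otimes>\<^sub>M M) (\<lambda>p. attached t (fst p) (snd p) \<noteq> None)" for t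
    by (intro pred_intros_logic pred_eq_const1[OF attached_measurable]) simp
qed

lemma rank_comp:
  assumes "a \<in> measurable N M" "b \<in> measurable N M"
  shows "(\<lambda>p. rank (a p) (b p)) \<in> measurable N (count_space UNIV)"
  using measurable_compose[OF measurable_Pair[OF assms] rank_measurable] by simp

lemma rank_fun_pred:
  assumes "a \<in> measurable N M" "b \<in> measurable N M"
  shows "Measurable.pred N (\<lambda>p. P (rank (a p) (b p)))"
  by (rule measurable_compose[OF rank_comp[OF assms]]) simp

lemma minimal_measurable:
  assumes i: "i \<in> I" and ab: "a \<in> measurable N M" "b \<in> measurable N M"
  shows "Measurable.pred N (\<lambda>p. minimal i (a p) (b p))"
proof -
  have fb: "(\<lambda>p. f m (b p)) \<in> measurable N M" for m
    by (rule measurable_compose[OF ab(2) f_measurable])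
  \<comment> \<open>Naming the value \<open>s\<close> reduces the comparison of two ranks to
    countably many comparisons with constants.\<close>
  have eq: "minimal i (a p) (b p) \<longleftrightarrow> (\<forall>m. (b p, f m (b p)) \<in> Ri i \<longrightarrow>
      (\<exists>s. rank (a p) (b p) = s \<and> s \<le> rank (a p) (f m (b p))))" for p
    by (simp add: minimal_def)
  show ?thesis unfolding eq
    by (intro pred_intros_logic pred_intros_countable in_pred[OF Ri_sets[OF i] ab(2) fb]
        rank_fun_pred[OF ab] rank_fun_pred[OF ab(1) fb])
qed

lemma toward_measurable:
  assumes i: "i \<in> I" and ab: "a \<in> measurable N M" "b \<in> measurable N M"
  shows "(\<lambda>p. toward i (a p) (b p)) \<in> measurable N M"
proof -
  have fb: "(\<lambda>p. f m (b p)) \<in> measurable N M" for m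
    by (rule measurable_compose[OF ab(2) f_measurable])
  have "(\<lambda>p. toward_index i (a p) (b p)) \<in> measurable N (count_space UNIV)"
    unfolding toward_index_def
  proof (rule measurable_If)
    show "(\<lambda>p. stage_parent (rank (a p) (b p) - 1)) \<in> measurable N (count_space UNIV)"
      by (rule measurable_compose[OF rank_comp[OF ab]]) simp
    show "(\<lambda>p. LEAST m. (b p, f m (b p)) \<in> Ri i \<and> minimal i (a p) (f m (b p))) \<in> measurable N (count_space UNIV)"
      by (intro measurable_Least pred_intros_logic in_pred[OF Ri_sets[OF i] ab(2) fb]
          minimal_measurable[OF i ab(1) fb])
    show "{p \<in> space N. rank (a p) (b p) \<noteq> 0 \<and> stage_factor I (rank (a p) (b p) - 1) = i} \<in> sets N"
      using rank_fun_pred[OF ab, of "\<lambda>s. s \<noteq> 0 \<and> stage_factor I (s - 1) = i"] by (simp add: pred_def)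
  qed
  then show ?thesis unfolding toward_def by (rule measurable_compose_countable[OF fb])
qed

lemma root_measurable:
  assumes ab: "a \<in> measurable N M" "b \<in> measurable N M"
  shows "(\<lambda>p. root (a p) (b p)) \<in> measurable N M"
proof -
  have fb: "(\<lambda>p. f m (b p)) \<in> measurable N M" for m
    by (rule measurable_compose[OF ab(2) f_measurable])
  have "(\<lambda>p. root_index (rank (a p) (b p))) \<in> measurable N (count_space UNIV)"
    by (rule measurable_compose[OF rank_comp[OF ab]]) simp
  then show ?thesis unfolding root_def by (rule measurable_compose_countable[OF fb])
qed

lemma conj_dom_sets:
  assumes i: "i \<in> I" shows "conj_dom i s \<in> sets M"
proof -
  have "Measurable.pred M (\<lambda>a. f (root_index s) (g (root_index s) a) = a \<and>
     rank a (g (root_index s) a) = s \<and> minimal i a (g (root_index s) a))"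
    by (intro pred_intros_logic eq_pred[OF measurable_compose[OF g_measurable f_measurable] measurable_ident_sets[OF refl]]
        rank_fun_pred[OF measurable_ident_sets[OF refl] g_measurable] minimal_measurable[OF i measurable_ident_sets[OF refl] g_measurable])
  then show ?thesis unfolding conj_dom_def pred_def by simp
qed

lemma S_space2: "p \<in> S \<Longrightarrow> p \<in> space (M \<Otimes>\<^sub>M M)"
  using sets.sets_into_space[OF S_sets] by blast

lemma conj_rel_sets:
  assumes i: "i \<in> I" shows "conj_rel i s \<in> sets (M \<Otimes>\<^sub>M M)"
proof -
  have "Measurable.pred (M \<Otimes>\<^sub>M M) (\<lambda>p. p \<in> S \<and> fst p \<in> conj_dom i s \<and> snd p \<in> conj_dom i s \<and>
      (g (root_index s) (fst p), g (root_index s) (snd p)) \<in> Ri i)"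
    by (intro pred_intros_logic pred_sets2[OF S_sets measurable_ident_sets[OF refl]]
        pred_sets2[OF conj_dom_sets[OF i] measurable_fst] pred_sets2[OF conj_dom_sets[OF i] measurable_snd]
        in_pred[OF Ri_sets[OF i]] measurable_compose[OF measurable_fst g_measurable]
        measurable_compose[OF measurable_snd g_measurable])
  moreover have "conj_rel i s = {p \<in> space (M \<Otimes>\<^sub>M M). p \<in> S \<and> fst p \<in> conj_dom i s \<and> snd p \<in> conj_dom i s \<and>
      (g (root_index s) (fst p), g (root_index s) (snd p)) \<in> Ri i}"
    unfolding conj_rel_def using S_space2 by auto
  ultimately show ?thesis by (simp add: pred_def)
qed

lemma conj_rel_equiv:
  assumes i: "i \<in> I" shows "equiv (conj_dom i s) (conj_rel i s)"
proof (rule equivI)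
  have "g n a \<in> space M" if "a \<in> space M" for n a
    using measurable_space[OF g_measurable that] .
  then show "refl_on (conj_dom i s) (conj_rel i s)"
    using S_refl Ri_refl[OF i] by (auto intro!: refl_onI simp: conj_rel_def conj_dom_def)
  show "sym (conj_rel i s)"
    using S_sym Ri_sym[OF i] by (auto intro!: symI simp: conj_rel_def)
  show "trans (conj_rel i s)"
    using S_trans Ri_trans[OF i] unfolding conj_rel_def by (blast intro!: transI)
  show "conj_rel i s \<subseteq> conj_dom i s \<times> conj_dom i s" by (auto simp: conj_rel_def)
qed

lemma tree_edges_sets: "tree_edges \<in> sets (M \<Otimes>\<^sub>M M)"
proof -
  let ?Q = "M \<Otimes>\<^sub>M M"
  \<comment> \<open>The point \<open>z\<close> lies in the \<open>R\<close>-class of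
    \<open>a\<close>, so the quantifier over \<open>z\<close> becomes one over the index
    \<open>m\<close> of a map \<open>f m\<close>.\<close>
  define E where "E = (\<lambda>i m. {p \<in> space ?Q. tree_edge (fst p) i (f m (fst p)) \<and>
      root (fst p) (f m (fst p)) = fst p \<and> snd p = root (fst p) (toward i (fst p) (f m (fst p)))})"
  have ff: "(\<lambda>p. f m (fst p)) \<in> measurable ?Q M" for m
    by (rule measurable_compose[OF measurable_fst f_measurable])
  have "Measurable.pred ?Q (\<lambda>p. tree_edge (fst p) i (f m (fst p)) \<and> root (fst p) (f m (fst p)) = fst p \<and>
      snd p = root (fst p) (toward i (fst p) (f m (fst p))))" if i: "i \<in> I" for i m
  proof -
    note t = toward_measurable[OF i measurable_fst ff]
    have "Measurable.pred ?Q (\<lambda>p. i = stage_factor I (rank (fst p) (f m (fst p)) - 1))"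
      using rank_fun_pred[OF measurable_fst ff, of "\<lambda>s. i = stage_factor I (s - 1)"] .
    then show ?thesis
      unfolding tree_edge_def
      by (intro pred_intros_logic in_pred[OF R_sets measurable_fst ff] in_pred[OF S_sets measurable_fst ff]
          eq_pred[OF t ff] eq_pred[OF root_measurable[OF measurable_fst ff] measurable_fst]
          eq_pred[OF measurable_snd root_measurable[OF measurable_fst t]])
         (simp add: i)
  qed
  then have "E i m \<in> sets ?Q" if "i \<in> I" for i m
    using that by (simp add: pred_def E_def)
  then have "(\<Union>i\<in>I. \<Union>m. E i m) \<in> sets ?Q"
    by (intro sets.countable_UN' I_countable) auto
  moreover have "tree_edges = (\<Union>i\<in>I. \<Union>m. E i m)" (is "_ = ?E")
  proof (intro equalityI subsetI)
    fix p assume p: "p \<in> tree_edges"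
    obtain a b where ab: "p = (a, b)" by (cases p)
    then obtain i z where z: "tree_edge a i z" "root a z = a" "b = root a (toward i a z)"
      using p unfolding tree_edges_def by auto
    obtain m where "z = f m a" using f_cover[OF tree_edgeD(2)[OF z(1)]] by blast
    then show "p \<in> ?E" unfolding E_def using z tree_edgeD(1)[OF z(1)] ab tree_edges_S S_space2[of p] p by auto
  next
    fix p assume "p \<in> ?E"
    then show "p \<in> tree_edges" unfolding tree_edges_def E_def by (cases p) auto
  qed
  ultimately show ?thesis by simp
qed

lemma tree_graph_sets: "tree_graph \<in> sets (M \<Otimes>\<^sub>M M)"
proof -
  have "Measurable.pred (M \<Otimes>\<^sub>M M) (\<lambda>p. (fst p, snd p) \<in> tree_edges \<or> (snd p, fst p) \<in> tree_edges)"
    by (intro pred_intros_logic in_pred[OF tree_edges_sets] measurable_fst measurable_snd)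
  moreover have "tree_graph = {p \<in> space (M \<Otimes>\<^sub>M M). (fst p, snd p) \<in> tree_edges \<or> (snd p, fst p) \<in> tree_edges}"
    using tree_graph_S S_space2 unfolding tree_graph_def by auto
  ultimately show ?thesis by (simp add: pred_def)
qed

text \<open>The maps \<open>f m\<close> enumerate the intermediate point of a composition, which
  keeps it Borel where a projection would in general only be analytic.\<close>

lemma tree_graph_relpow_pred:
  "Measurable.pred (M \<Otimes>\<^sub>M M) (\<lambda>p. (fst p, snd p) \<in> tree_graph ^^ n)"
proof (induction n)
  case 0
  show ?case using eq_pred[OF measurable_fst measurable_snd]
    by (simp only: relpow.simps(1) pair_in_Id_conv)
next
  case (Suc n)
  have ff: "(\<lambda>p. f m (fst p)) \<in> measurable (M \<Otimes>\<^sub>M M) M" for m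
    by (rule measurable_compose[OF measurable_fst f_measurable])
  have IH: "Measurable.pred (M \<Otimes>\<^sub>M M) (\<lambda>p. (fst p, f m (fst p)) \<in> tree_graph ^^ n)" for m
    using measurable_compose[OF measurable_Pair[OF measurable_fst ff] Suc] by simp
  have step: "Measurable.pred (M \<Otimes>\<^sub>M M) (\<lambda>p. \<exists>m. (fst p, f m (fst p)) \<in> tree_graph ^^ n \<and> (f m (fst p), snd p) \<in> tree_graph)"
    by (intro pred_intros_logic pred_intros_countable IH in_pred[OF tree_graph_sets ff measurable_snd])
  have eq: "(fst p, snd p) \<in> tree_graph ^^ Suc n \<longleftrightarrow>
      (\<exists>m. (fst p, f m (fst p)) \<in> tree_graph ^^ n \<and> (f m (fst p), snd p) \<in> tree_graph)"
    if p: "p \<in> space (M \<Otimes>\<^sub>M M)" for p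
  proof
    assume "(fst p, snd p) \<in> tree_graph ^^ Suc n"
    then obtain y where y: "(fst p, y) \<in> tree_graph ^^ n" "(y, snd p) \<in> tree_graph" by auto
    have "(fst p, y) \<in> tree_graph\<^sup>*" using y(1) by (rule relpow_imp_rtrancl)
    moreover have "fst p \<in> space M" using p by (auto simp: space_pair_measure)
    ultimately obtain m where "f m (fst p) = y"
      using f_cover[OF S_imp_R[OF tree_graph_rtrancl_S]] by blast
    then show "\<exists>m. (fst p, f m (fst p)) \<in> tree_graph ^^ n \<and> (f m (fst p), snd p) \<in> tree_graph"
      using y by blast
  next
    assume "\<exists>m. (fst p, f m (fst p)) \<in> tree_graph ^^ n \<and> (f m (fst p), snd p) \<in> tree_graph"
    then show "(fst p, snd p) \<in> tree_graph ^^ Suc n" by (elim exE conjE) (rule relpow_Suc_I)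
  qed
  show ?case by (rule measurable_cong[THEN iffD2, OF eq step])
qed

lemma tree_rel_sets: "tree_rel \<in> sets (M \<Otimes>\<^sub>M M)"
proof -
  have "Measurable.pred (M \<Otimes>\<^sub>M M) (\<lambda>p. \<exists>n. (fst p, snd p) \<in> tree_graph ^^ n)"
    by (intro pred_intros_countable tree_graph_relpow_pred)
  moreover have "tree_rel = {p \<in> space (M \<Otimes>\<^sub>M M). \<exists>n. (fst p, snd p) \<in> tree_graph ^^ n}"
    unfolding tree_rel_def rtrancl_is_UN_relpow by (auto simp: space_pair_measure)
  ultimately show ?thesis by (simp add: pred_def)
qed

lemma tree_subrelation: "subrelation_on M S (space M) tree_rel"
  unfolding subrelation_on_def borel_equiv_on_def
  using tree_rel_sets tree_rel_equiv tree_rel_S by simp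

lemma tree_rel_arborable:
  assumes cnt: "countable_classes (space M) R"
  shows "arborable M tree_rel"
  unfolding arborable_def
proof (intro conjI exI)
  show "borel_equiv_on M (space M) tree_rel"
    using tree_subrelation unfolding subrelation_on_def by simp
  show "countable_classes (space M) tree_rel"
    unfolding countable_classes_def
  proof
    fix C assume "C \<in> space M // tree_rel"
    then obtain x where x: "x \<in> space M" "C = tree_rel `` {x}" by (rule quotientE)
    then have "C \<subseteq> R `` {x}" using tree_rel_S S_R by blast
    moreover have "countable (R `` {x})"
      using cnt quotientI[OF x(1)] unfolding countable_classes_def by blast
    ultimately show "countable C" by (rule countable_subset)
  qed
  have "tree_graph\<^sup>* `` {x} = tree_rel `` {x}" if "x \<in> space M" for x
    using that S_space(2)[OF tree_graph_rtrancl_S[OF _ that]] unfolding tree_rel_def by auto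
  then show "space M // tree_graph\<^sup>* = space M // tree_rel"
    unfolding quotient_def by auto
qed (rule tree_graph_sets sym_tree_graph tree_graph_irrefl tree_graph_acyclic)+

lemma fam_subrelation:
  assumes p: "p \<in> ix" shows "subrelation_on M S (space M) (fam p)"
  using p
proof (cases rule: ix_cases)
  case (2 i s)
  have fam: "fam p = conj_rel i s \<union> Id_on (space M - conj_dom i s)"
    using 2 by (simp add: fam_def kurosh_family_def extend_by_equality_def)
  have "Measurable.pred (M \<Otimes>\<^sub>M M) (\<lambda>p. fst p = snd p \<and> fst p \<notin> conj_dom i s)"
    by (intro pred_intros_logic eq_pred measurable_fst measurable_snd
        pred_sets2[OF conj_dom_sets[OF 2(2)] measurable_fst])
  moreover have "Id_on (space M - conj_dom i s) = {p \<in> space (M \<Otimes>\<^sub>M M). fst p = snd p \<and> fst p \<notin> conj_dom i s}"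
    by (auto simp: space_pair_measure)
  ultimately have "Id_on (space M - conj_dom i s) \<in> sets (M \<Otimes>\<^sub>M M)" by (simp add: pred_def)
  then have "fam p \<in> sets (M \<Otimes>\<^sub>M M)" unfolding fam using conj_rel_sets[OF 2(2)] by auto
  moreover have "equiv (space M) (fam p)"
  proof -
    note c = equiv_dest[OF conj_rel_equiv[OF 2(2), of s]]
    have d: "conj_dom i s \<subseteq> space M" by (auto simp: conj_dom_def)
    show ?thesis
    proof (rule equivI)
      show "refl_on (space M) (fam p)" using c(1) unfolding fam by (auto intro!: refl_onI)
      show "sym (fam p)" using c(2) unfolding fam by (auto intro!: symI)
      show "trans (fam p)" using c(3-5) unfolding fam by (fastforce intro!: transI)
      show "fam p \<subseteq> space M \<times> space M" using c(4,5) d unfolding fam by auto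
    qed
  qed
  ultimately show ?thesis
    unfolding subrelation_on_def borel_equiv_on_def using fam_S[OF p] by simp
qed (simp add: tree_subrelation)

theorem fam_free_product: "countable_free_product M S ix fam"
  unfolding countable_free_product_def
proof (intro conjI ballI fam_subrelation fam_generated fam_free)
  show "countable ix" unfolding ix_def kurosh_index_def using I_countable by auto
qed

section \<open>The partial isomorphisms and the distinguished factors\<close>

lemma conj_dom_pseudogroup:
  assumes i: "i \<in> I"
  shows "in_full_pseudogroup M R (conj_dom i s) (g (root_index s) ` conj_dom i s) (g (root_index s))"
  unfolding in_full_pseudogroup_def
proof (intro conjI ballI)
  let ?n = "root_index s"
  let ?B = "g ?n ` conj_dom i s"
  show "conj_dom i s \<in> sets M" by (rule conj_dom_sets[OF i])
  have fg: "f ?n (g ?n a) = a" "a \<in> space M" if "a \<in> conj_dom i s" for a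
    using that by (auto simp: conj_dom_def)
  \<comment> \<open>Described through the inverse map, the image is a Borel preimage.\<close>
  have B: "?B = {z \<in> space M. f ?n z \<in> conj_dom i s \<and> g ?n (f ?n z) = z}"
    using fg measurable_space[OF g_measurable] by (auto simp: image_iff) metis
  have "Measurable.pred M (\<lambda>z. f ?n z \<in> conj_dom i s \<and> g ?n (f ?n z) = z)"
    by (intro pred_intros_logic pred_sets2[OF conj_dom_sets[OF i] f_measurable]
        eq_pred[OF measurable_compose[OF f_measurable g_measurable] measurable_ident_sets[OF refl]])
  then show "?B \<in> sets M" unfolding B by (simp add: pred_def)
  show "(a, g ?n a) \<in> R" if "a \<in> conj_dom i s" for a using g_R fg that by blast
  have inj: "inj_on (g ?n) (conj_dom i s)" by (rule inj_on_inverseI[of _ "f ?n"]) (rule fg)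
  have inv: "the_inv_into (conj_dom i s) (g ?n) z = f ?n z" if "z \<in> ?B" for z
    using that the_inv_into_f_f[OF inj] fg(1) by auto
  show "borel_isomorphism M (conj_dom i s) ?B (g ?n)"
    unfolding borel_isomorphism_def
  proof (intro conjI)
    show "bij_betw (g ?n) (conj_dom i s) ?B" using inj by (rule inj_on_imp_bij_betw)
    show "g ?n \<in> measurable (restrict_space M (conj_dom i s)) (restrict_space M ?B)"
      by (intro measurable_restrict_space2 measurable_restrict_space1 g_measurable)
         (auto simp: space_restrict_space)
    have "f ?n \<in> measurable (restrict_space M ?B) (restrict_space M (conj_dom i s))"
      by (intro measurable_restrict_space2 measurable_restrict_space1 f_measurable)
         (use fg in \<open>auto simp: space_restrict_space\<close>)
    then show "the_inv_into (conj_dom i s) (g ?n) \<in> measurable (restrict_space M ?B) (restrict_space M (conj_dom i s))"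
      by (subst measurable_cong[where g = "f ?n"]) (auto simp: space_restrict_space inv)
  qed
qed

lemma conj_rel_pullback:
  "conj_rel i s = pullback_rel (conj_dom i s) (g (root_index s))
     (restrict_rel (Ri i) (g (root_index s) ` conj_dom i s)) \<inter> S"
  unfolding conj_rel_def pullback_rel_def restrict_rel_def by auto

text \<open>Every point has rank 0 relative to its own \<open>S\<close>-class, and the root map of
  rank 0 is the identity.\<close>

lemma conj_dom_0:
  assumes i: "i \<in> I" shows "conj_dom i 0 = space M"
proof -
  have "rank a a = 0" if "a \<in> space M" for a
    using rank_0_iff[OF R_refl[OF that]] S_refl[OF that] by simp
  then show ?thesis by (auto simp: conj_dom_def f_0 g_0 minimal_def)
qed

lemma conj_rel_0:
  assumes i: "i \<in> I" shows "conj_rel i 0 = Ri i \<inter> S"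
  unfolding conj_rel_def conj_dom_0[OF i] using S_space by (auto simp: g_0)

end

theorem mainTheorem1:
  fixes M :: "'a measure" and R :: "'a rel" and I :: "'i set" and Ri :: "'i \<Rightarrow> 'a rel"
    and S :: "'a rel"
  assumes "standard_borel_space M"
    and "borel_equiv_on M (space M) R"
    and "countable_classes (space M) R"
    and "countable_free_product M R I Ri"
    and "subrelation_on M R (space M) S"
  shows "\<exists>(K :: 'i \<Rightarrow> nat set) (A :: 'i \<Rightarrow> nat \<Rightarrow> 'a set) (\<phi> :: 'i \<Rightarrow> nat \<Rightarrow> 'a \<Rightarrow> 'a)
            (Sk :: 'i \<Rightarrow> nat \<Rightarrow> 'a rel) (T :: 'a rel).
    countable_free_product M S (kurosh_index I K) (kurosh_family M A Sk T) \<and>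
    (\<forall>i\<in>I. \<forall>k\<in>K i.
       in_full_pseudogroup M R (A i k) (\<phi> i k ` A i k) (\<phi> i k) \<and>
       Sk i k =
         pullback_rel (A i k) (\<phi> i k) (restrict_rel (Ri i) (\<phi> i k ` A i k)) \<inter> S) \<and>
    subrelation_on M S (space M) T \<and> arborable M T \<and>
    (\<forall>i\<in>I. \<exists>k\<in>K i. A i k = space M \<and> Sk i k = Ri i \<inter> S)"
proof -
  have R: "R \<in> sets (M \<Otimes>\<^sub>M M)" "equiv (space M) R"
    using assms(2) unfolding borel_equiv_on_def by auto
  have S: "S \<in> sets (M \<Otimes>\<^sub>M M)" "equiv (space M) S" "S \<subseteq> R"
    using assms(5) unfolding subrelation_on_def borel_equiv_on_def by auto
  have I: "countable I" "generated_by (space M) R I Ri" "free_family I Ri"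
    "\<And>i. i \<in> I \<Longrightarrow> Ri i \<in> sets (M \<Otimes>\<^sub>M M)" "\<And>i. i \<in> I \<Longrightarrow> equiv (space M) (Ri i)"
    using assms(4) unfolding countable_free_product_def subrelation_on_def borel_equiv_on_def by auto
  obtain f g :: "nat \<Rightarrow> 'a \<Rightarrow> 'a" where fg: "\<And>n. f n \<in> measurable M M" "\<And>n. g n \<in> measurable M M"
    "f 0 = (\<lambda>x. x)" "g 0 = (\<lambda>x. x)"
    "\<And>n x. x \<in> space M \<Longrightarrow> (x, f n x) \<in> R" "\<And>n x. x \<in> space M \<Longrightarrow> (x, g n x) \<in> R"
    "\<And>x y. (x, y) \<in> R \<Longrightarrow> \<exists>n. f n x = y \<and> g n y = x"
    by (rule feldman_moore[OF assms(1,2,3)]) (rule that)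
  interpret kurosh_setting M R I Ri S f g
    by (unfold_locales; (rule R S I fg diagonal_measurable[OF assms(1)])?)
  let ?K = "\<lambda>_ :: 'i. UNIV :: nat set"
  show ?thesis
  proof (intro exI conjI ballI)
    show "countable_free_product M S (kurosh_index I ?K) (kurosh_family M conj_dom conj_rel tree_rel)"
      using fam_free_product unfolding ix_def fam_def .
    show "subrelation_on M S (space M) tree_rel" by (rule tree_subrelation)
    show "arborable M tree_rel" by (rule tree_rel_arborable[OF assms(3)])
    fix i assume i: "i \<in> I"
    show "\<exists>k\<in>UNIV. conj_dom i k = space M \<and> conj_rel i k = Ri i \<inter> S"
      using conj_dom_0[OF i] conj_rel_0[OF i] by blast
    fix k
    show "in_full_pseudogroup M R (conj_dom i k) (g (root_index k) ` conj_dom i k) (g (root_index k))"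
      by (rule conj_dom_pseudogroup[OF i])
    show "conj_rel i k = pullback_rel (conj_dom i k) (g (root_index k))
        (restrict_rel (Ri i) (g (root_index k) ` conj_dom i k)) \<inter> S"
      by (rule conj_rel_pullback)
  qed
qed

end
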